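(* Let $A \subset \mathbb{R}$ be finite. Then $$|A+A| + |A-A| + |AA| + |AA^{-1}| \gtrsim |A|^{4/3 + 1/753}.$$
   Context: $A\pm A=\{a\pm b: a,b\in A\}$, $AA = \{ab: a,b\in A\}$, $A^{-1} = \{a^{-1} : a\in A\}$ with the convention $0^{-1}=0$, and $AA^{-1}=\{ab: a\in A, b\in A^{-1}\}$. The notation $b \gtrsim a$ means $a = O(b \log^c |A|)$ for some absolute constant $c>0$. *)

theory Defs
  imports Complex_Main "HOL-Library.Set_Algebras" "HOL-Library.Landau_Symbols"
begin

text \<open>
  Sumsets and product sets are \<open>A + A\<close> and \<open>A * A\<close> from \<open>Set_Algebras\<close>, and \<open>A\<^sup>-\<^sup>1\<close> is
  \<open>inverse ` A\<close>; the convention \<open>inverse 0 = 0\<close> is the required one. The difference set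
  needs a name of its own, since \<open>A - B\<close> denotes the set-theoretic difference.
\<close>

definition diffset :: "'a::minus set \<Rightarrow> 'a set \<Rightarrow> 'a set" where
  "diffset A B = {a - b | a b. a \<in> A \<and> b \<in> B}"

text \<open>
  \<open>gtrsim b a\<close> is the relation \<open>b(A) >~ a(A)\<close> between two quantities depending on a finite set
  \<open>A\<close> of reals: \<open>a = O(b log\<^sup>c |A|)\<close> for some \<open>c > 0\<close>. Both \<open>c\<close> and the implied constant are
  independent of \<open>A\<close>. The principal filter makes the estimate hold for \<^emph>\<open>every\<close> finite \<open>A\<close> with
  \<open>|A| \<ge> 2\<close>, not just for large ones; sets with one element must be left out because
  \<open>log 1 = 0\<close>.
\<close>

definition gtrsim :: "(real set \<Rightarrow> real) \<Rightarrow> (real set \<Rightarrow> real) \<Rightarrow> bool" where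
  "gtrsim b a \<longleftrightarrow>
     (\<exists>c>0. a \<in> O[principal {A. finite A \<and> card A \<ge> 2}](\<lambda>A. b A * ln (real (card A)) powr c))"

end

theory Submission
  imports Defs "HOL-Analysis.Harmonic_Numbers" "HOL-Analysis.Convex"
begin

text \<open>
  Let \<open>A\<close> consist of \<open>n\<close> positive reals and let \<open>N\<close> bound the four cardinalities; ignore logarithms.
  Solymosi's argument bounds the multiplicative energy of \<open>A\<close> by \<open>N\<^sup>2\<close>. It compares sums along
  neighbouring lines of slopes \<open>t \<in> A / A\<close>, so if it is nearly sharp then the fibres
  \<open>{a \<in> A. t * a \<in> A}\<close> of most popular \<open>t\<close> are additively structured: linear equations between them
  have many solutions (Konyagin and Shkredov). By the Szemeredi--Trotter bound such a fibre has
  small multiplicative energy, hence, by Cauchy--Schwarz, a large product set with \<open>A\<close>. That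
  product set lies in \<open>A * A\<close> together with its dilate by \<open>t\<close> (Katz and Koester), so a large
  \<open>C \<subseteq> A\<close> consists, up to dilation, of ratios of elements of \<open>A * A\<close> with many representations.
  Szemeredi--Trotter then controls the additive energies of \<open>C\<close>, and the argument of Schoen and
  Shkredov makes \<open>C - C\<close> large. The outcome is \<open>n ^ 191 \<lesssim> N ^ 143\<close>, which is slightly stronger than
  needed (\<open>191 / 143 = 4 / 3 + 1 / 429\<close>) and so absorbs the logarithms.
\<close>

text \<open>Sources of the exponents, with n the size of \<open>A\<close> and logarithms dropped.
  There are at most N quotients, so some fibre size \<tau> of order at least n^2 / N is reached by
  about n^2 / \<tau> slopes. Blocks of m slopes without coincidences would improve Solymosi's bound
  by a factor m, impossible once m exceeds a multiple of N^2 / (n^2 \<tau>). For such m coincidences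
  occur, and they give n^4 \<tau>^2 <= m^8 N^2 X^2 for the size X of the product of \<open>A\<close>
  with a fibre. Inserting m and \<tau> yields X >= \<theta> = n^20 / N^14; at the critical size N =
  n^(4/3) this equals N, the most that a subset of \<open>A * A\<close> allows. The final stage
  gives n^11 \<theta>^9 <= N^17, which fails at N = n^(4/3); eliminating \<theta> produces 191 and
  143. A coincidence supplies only one good slope, whereas most slopes have to be good. The block
  argument is therefore run on the bad slopes alone: if they were more than half of all slopes, one
  of them would turn out to be good.\<close>

section \<open>Layer sums and moments\<close>

text \<open>Layer-cake summation: each side adds \<open>g k\<close> over the pairs (x, k) with 1 <=
  k <= \<open>r x\<close>.\<close>

lemma sum_layers:
  fixes r :: "'a \<Rightarrow> nat" and g :: "nat \<Rightarrow> real"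
  assumes "finite S" and "\<And>x. x \<in> S \<Longrightarrow> r x \<le> R"
  shows "(\<Sum>x\<in>S. \<Sum>k=1..r x. g k) = (\<Sum>k=1..R. g k * card {x\<in>S. k \<le> r x})"
proof -
  have "(\<Sum>x\<in>S. \<Sum>k=1..r x. g k) = (\<Sum>x\<in>S. \<Sum>k=1..R. if k \<le> r x then g k else 0)"
  proof (rule sum.cong[OF refl])
    fix x assume "x \<in> S"
    hence "{1..r x} = {k\<in>{1..R}. k \<le> r x}" using assms(2)[of x] by auto
    thus "(\<Sum>k=1..r x. g k) = (\<Sum>k=1..R. if k \<le> r x then g k else 0)"
      by (simp only: sum.inter_filter[OF finite_atLeastAtMost])
  qed
  also have "\<dots> = (\<Sum>k=1..R. \<Sum>x\<in>S. if k \<le> r x then g k else 0)" by (rule sum.swap)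
  also have "\<dots> = (\<Sum>k=1..R. g k * card {x\<in>S. k \<le> r x})"
    by (rule sum.cong[OF refl]) (simp add: sum.inter_filter[OF assms(1), symmetric])
  finally show ?thesis .
qed

lemma square_le_layers: "real k ^ 2 \<le> (\<Sum>j=1..k. 2 * real j)"
  by (induction k) (auto simp: power2_eq_square algebra_simps)

text \<open>The increments of j^3 are at most 3 j^2. The first layer keeps its exact weight 1: it is
  counted separately, since the incidence bound starts at k = 2.\<close>

lemma cube_le_layers: "real k ^ 3 \<le> (\<Sum>j=1..k. if j = 1 then 1 else 3 * real j ^ 2)"
proof (induction k)
  case (Suc k)
  then show ?case by (cases "k = 0") (auto simp: power2_eq_square power3_eq_cube algebra_simps)
qed simp

lemma sum_inverse_le_harm:
  assumes "K \<subseteq> {1..R}"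
  shows "(\<Sum>k\<in>K. 1 / real k) \<le> harm R"
  unfolding harm_def using assms by (auto simp: field_simps intro!: sum_mono2)

lemma harm_ge_1: "R \<ge> 1 \<Longrightarrow> (1::real) \<le> harm R"
  using sum_inverse_le_harm[of "{1}" R] by simp

text \<open>Replaces dyadic pigeonholing: if every k failed, f k would lie below V / (harm R * k),
  and these bounds add up to at most V. The price is one logarithm.\<close>

lemma harmonic_pigeonhole:
  fixes f :: "nat \<Rightarrow> real"
  assumes K: "K \<subseteq> {1..R}" and "V \<le> (\<Sum>k\<in>K. f k)" and "V > 0"
  shows "\<exists>k\<in>K. V \<le> harm R * (k * f k)"
proof (rule ccontr)
  assume neg: "\<not> (\<exists>k\<in>K. V \<le> harm R * (k * f k))"
  hence lt: "harm R * (k * f k) < V" if "k \<in> K" for k using that by (meson linorder_not_less)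
  have "K \<noteq> {}" using assms by auto
  then obtain k0 where "k0 \<in> K" by auto
  hence "R \<ge> 1" using K by auto
  hence h: "(1::real) \<le> harm R" by (rule harm_ge_1)
  have fin: "finite K" using K finite_subset by blast
  have "(\<Sum>k\<in>K. f k) < (\<Sum>k\<in>K. V / harm R * (1 / real k))"
  proof (rule sum_strict_mono[OF fin \<open>K \<noteq> {}\<close>])
    fix k assume "k \<in> K"
    hence "real k > 0" using K by auto
    hence "harm R * real k > 0" using h by (intro mult_pos_pos) linarith+
    with lt[OF \<open>k \<in> K\<close>] show "f k < V / harm R * (1 / real k)"
      by (simp add: pos_less_divide_eq mult_ac)
  qed
  also have "\<dots> \<le> V / harm R * harm R"
    unfolding sum_distrib_left[symmetric]
    using sum_inverse_le_harm[OF K] h \<open>V > 0\<close> by (intro mult_left_mono) auto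
  also have "\<dots> = V" using h by simp
  finally show False using assms by simp
qed

text \<open>Layer k contributes at most 2 k * V / k^2 = 2 V / k, and the harmonic sum is the
  logarithm.\<close>

lemma sum_squares_le_harm:
  fixes r :: "'a \<Rightarrow> nat"
  assumes "finite S" and "\<And>x. x \<in> S \<Longrightarrow> r x \<le> R"
    and "\<And>k. k \<ge> 1 \<Longrightarrow> k \<le> R \<Longrightarrow> real (card {x\<in>S. k \<le> r x}) * real k ^ 2 \<le> V"
  shows "(\<Sum>x\<in>S. real (r x) ^ 2) \<le> 2 * V * harm R"
proof -
  have "(\<Sum>x\<in>S. real (r x) ^ 2) \<le> (\<Sum>x\<in>S. \<Sum>k=1..r x. 2 * real k)"
    by (intro sum_mono square_le_layers)
  also have "\<dots> = (\<Sum>k=1..R. 2 * real k * card {x\<in>S. k \<le> r x})" by (rule sum_layers[OF assms(1,2)])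
  also have "\<dots> \<le> (\<Sum>k=1..R. 2 * V * inverse (real k))"
  proof (rule sum_mono)
    fix k assume "k \<in> {1..R}"
    with assms(3)[of k] show "2 * real k * card {x\<in>S. k \<le> r x} \<le> 2 * V * inverse (real k)"
      by (auto simp: field_simps power2_eq_square)
  qed
  finally show ?thesis by (simp add: harm_def sum_distrib_left)
qed

text \<open>As for squares, with 3 k^2 * V / k^3 in layer k; layer 1 stays as a bare count.\<close>

lemma sum_cubes_le_harm:
  fixes r :: "'a \<Rightarrow> nat"
  assumes "finite S" and "\<And>x. x \<in> S \<Longrightarrow> r x \<le> R" and "V \<ge> 0"
    and "\<And>k. k \<ge> 2 \<Longrightarrow> k \<le> R \<Longrightarrow> real (card {x\<in>S. k \<le> r x}) * real k ^ 3 \<le> V"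
  shows "(\<Sum>x\<in>S. real (r x) ^ 3) \<le> real (card {x\<in>S. 1 \<le> r x}) + 3 * V * harm R"
proof -
  let ?g = "\<lambda>j. if j = 1 then 1 else 3 * real j ^ 2"
  have "(\<Sum>x\<in>S. real (r x) ^ 3) \<le> (\<Sum>x\<in>S. \<Sum>k=1..r x. ?g k)"
    by (intro sum_mono cube_le_layers)
  also have "\<dots> = (\<Sum>k=1..R. ?g k * card {x\<in>S. k \<le> r x})" by (rule sum_layers[OF assms(1,2)])
  also have "\<dots> \<le> (\<Sum>k=1..R. (if k = 1 then real (card {x\<in>S. 1 \<le> r x}) else 0) + 3 * V * inverse (real k))"
  proof (rule sum_mono)
    fix k assume k: "k \<in> {1..R}"
    show "?g k * card {x\<in>S. k \<le> r x} \<le>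
        (if k = 1 then real (card {x\<in>S. 1 \<le> r x}) else 0) + 3 * V * inverse (real k)"
    proof (cases "k = 1")
      case False
      with k assms(4)[of k] show ?thesis by (auto simp: field_simps power3_eq_cube power2_eq_square)
    qed (use \<open>V \<ge> 0\<close> in simp)
  qed
  also have "\<dots> \<le> real (card {x\<in>S. 1 \<le> r x}) + 3 * V * harm R"
    by (simp add: sum.distrib harm_def sum_distrib_left)
  finally show ?thesis .
qed

section \<open>Cauchy-Schwarz and Hoelder inequalities, and counting of collisions\<close>

lemma square_sum_le_card:
  fixes f :: "'a \<Rightarrow> real"
  assumes "finite S"
  shows "(\<Sum>x\<in>S. f x)^2 \<le> card S * (\<Sum>x\<in>S. f x ^ 2)"
  using sum_squared_le_sum_of_squares[of f S] assms by (simp add: mult.commute)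

text \<open>Cauchy-Schwarz for f^2 = f^(1/2) * f^(3/2). It turns a third moment, which incidence
  bounds control, into a second moment.\<close>

lemma sum_squares_le_sum_cubes:
  fixes f :: "'a \<Rightarrow> real"
  assumes "\<And>x. x \<in> S \<Longrightarrow> f x \<ge> 0"
  shows "(\<Sum>x\<in>S. f x ^ 2)^2 \<le> (\<Sum>x\<in>S. f x) * (\<Sum>x\<in>S. f x ^ 3)"
proof -
  have "(\<Sum>x\<in>S. f x ^ 2)^2 = (\<Sum>x\<in>S. sqrt (f x) * (sqrt (f x) * f x))^2"
    using assms by (intro arg_cong[of _ _ "\<lambda>t. t ^ 2"] sum.cong) (auto simp: power2_eq_square mult.assoc[symmetric])
  also have "\<dots> \<le> (\<Sum>x\<in>S. sqrt (f x) ^ 2) * (\<Sum>x\<in>S. (sqrt (f x) * f x) ^ 2)"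
    by (rule Cauchy_Schwarz_ineq_sum)
  also have "\<dots> = (\<Sum>x\<in>S. f x) * (\<Sum>x\<in>S. f x ^ 3)"
    using assms by (intro arg_cong2[of _ _ _ _ "(*)"] sum.cong)
      (auto simp: power_mult_distrib power2_eq_square power3_eq_cube)
  finally show ?thesis .
qed

text \<open>Hoelder's inequality from two uses of Cauchy-Schwarz: the fourth power of the sum s is
  at most card^2 * s * (sum of cubes), and one factor s cancels.\<close>

lemma cube_sum_le_card:
  fixes f :: "'a \<Rightarrow> real"
  assumes "finite S" and "\<And>x. x \<in> S \<Longrightarrow> f x \<ge> 0"
  shows "(\<Sum>x\<in>S. f x)^3 \<le> real (card S)^2 * (\<Sum>x\<in>S. f x ^ 3)"
proof (cases "(\<Sum>x\<in>S. f x) = 0")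
  case True
  then show ?thesis using assms by (auto intro!: sum_nonneg mult_nonneg_nonneg)
next
  case False
  let ?s = "\<Sum>x\<in>S. f x"
  have pos: "?s > 0" using False assms by (simp add: sum_nonneg order.not_eq_order_implies_strict)
  have "?s ^ 4 = (?s^2)^2" by simp
  also have "\<dots> \<le> (card S * (\<Sum>x\<in>S. f x ^ 2))^2"
    by (intro power_mono square_sum_le_card assms) auto
  also have "\<dots> = real (card S)^2 * (\<Sum>x\<in>S. f x ^ 2)^2" by (simp add: power_mult_distrib)
  also have "\<dots> \<le> real (card S)^2 * (?s * (\<Sum>x\<in>S. f x ^ 3))"
    by (intro mult_left_mono sum_squares_le_sum_cubes assms) auto
  finally have "?s * ?s ^ 3 \<le> ?s * (real (card S)^2 * (\<Sum>x\<in>S. f x ^ 3))"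
    by (simp add: eval_nat_numeral mult_ac)
  thus ?thesis using pos by simp
qed

lemma card_eq_sum_fibres:
  assumes "finite S" and "f ` S \<subseteq> T" and "finite T"
  shows "card S = (\<Sum>v\<in>T. card {x\<in>S. f x = v})"
proof -
  have "(\<Sum>v\<in>T. card {x\<in>S. f x = v}) = (\<Sum>v\<in>T. \<Sum>x\<in>S. if f x = v then 1 else 0)"
    using assms by (simp add: sum.inter_filter[symmetric])
  also have "\<dots> = (\<Sum>x\<in>S. \<Sum>v\<in>T. if f x = v then 1 else 0)" by (rule sum.swap)
  also have "\<dots> = (\<Sum>x\<in>S. 1)" using assms by (intro sum.cong) auto
  finally show ?thesis by simp
qed

text \<open>The colliding pairs number the sum of the squared fibre sizes, so this is Cauchy-Schwarz
  over the values of \<open>f\<close>.\<close>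

lemma card_collisions:
  assumes "finite S"
  shows "real (card S)^2 \<le> real (card (f ` S)) * real (card {(x, y). x \<in> S \<and> y \<in> S \<and> f x = f y})"
proof -
  let ?c = "\<lambda>v. card {x\<in>S. f x = v}"
  let ?E = "{(x, y). x \<in> S \<and> y \<in> S \<and> f x = f y}"
  have fE: "finite ?E" by (rule finite_subset[of _ "S \<times> S"]) (use assms in auto)
  have "card ?E = (\<Sum>v\<in>f ` S. card {p \<in> ?E. f (fst p) = v})"
    by (rule card_eq_sum_fibres[OF fE]) (use assms in auto)
  also have "\<dots> = (\<Sum>v\<in>f ` S. ?c v ^ 2)"
  proof (rule sum.cong[OF refl])
    fix v
    have "{p \<in> ?E. f (fst p) = v} = {x\<in>S. f x = v} \<times> {x\<in>S. f x = v}" by auto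
    thus "card {p \<in> ?E. f (fst p) = v} = ?c v ^ 2" by (simp add: card_cartesian_product power2_eq_square)
  qed
  finally have E: "real (card ?E) = (\<Sum>v\<in>f ` S. real (?c v) ^ 2)" by simp
  have "real (card S) = (\<Sum>v\<in>f ` S. real (?c v))"
    using card_eq_sum_fibres[OF assms, of f "f ` S"] assms by simp
  thus ?thesis unfolding E using square_sum_le_card[of "f ` S" "\<lambda>v. real (?c v)"] assms by simp
qed

section \<open>Incidences in grids\<close>

text \<open>The pair (m, c) codes the line y = m x + c, so vertical lines do not occur; horizontal
  ones are excluded by hypotheses on \<open>fst\<close>.\<close>

definition incidences :: "real set \<Rightarrow> real set \<Rightarrow> real \<times> real \<Rightarrow> nat" where
  "incidences X Y = (\<lambda>(m, c). card {x\<in>X. m * x + c \<in> Y})"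

text \<open>The number of the run of \<open>w\<close> consecutive elements of \<open>X\<close> in
  which x lies. Cutting by rank, not by length, bounds the size of every run.\<close>

definition block :: "real set \<Rightarrow> nat \<Rightarrow> real \<Rightarrow> nat" where
  "block X w x = card {x'\<in>X. x' < x} div w"

lemma block_mono: "finite X \<Longrightarrow> x \<le> y \<Longrightarrow> block X w x \<le> block X w y"
  unfolding block_def by (intro div_le_mono card_mono) auto

lemma card_less_inj:
  assumes "finite (X :: real set)"
  shows "inj_on (\<lambda>x. card {x'\<in>X. x' < x}) X"
proof (rule linorder_inj_onI)
  fix x y assume xy: "x < y" "x \<in> X" "y \<in> X"
  hence "card {x'\<in>X. x' < x} < card {x'\<in>X. x' < y}"
    using assms by (intro psubset_card_mono) auto
  thus "card {x'\<in>X. x' < x} \<noteq> card {x'\<in>X. x' < y}" by simp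
qed auto

lemma card_block_le:
  assumes "finite X" and "w > 0"
  shows "card {x\<in>X. block X w x = b} \<le> w"
proof -
  have "card {x\<in>X. block X w x = b} = card ((\<lambda>x. card {x'\<in>X. x' < x}) ` {x\<in>X. block X w x = b})"
    by (intro card_image[symmetric] inj_on_subset[OF card_less_inj[OF assms(1)]]) auto
  also have "\<dots> \<le> card {b * w..<b * w + w}"
  proof (intro card_mono subsetI)
    fix n assume "n \<in> (\<lambda>x. card {x'\<in>X. x' < x}) ` {x\<in>X. block X w x = b}"
    hence "n div w = b" unfolding block_def by auto
    hence "b * w + n mod w = n" by (metis div_mult_mod_eq)
    moreover have "n mod w < w" using \<open>w > 0\<close> by simp
    ultimately show "n \<in> {b * w..<b * w + w}" unfolding atLeastLessThan_iff by linarith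
  qed simp
  finally show ?thesis by simp
qed

text \<open>The length \<open>card X div r + 1\<close> exceeds card X / r, so \<open>r\<close>
  blocks suffice.\<close>

lemma block_less:
  assumes "finite X" and "x \<in> X" and "r > 0"
  shows "block X (card X div r + 1) x < r"
proof -
  have "card {x'\<in>X. x' < x} < card X" using assms by (intro psubset_card_mono) auto
  also have "\<dots> < r * (card X div r + 1)"
    using dividend_less_times_div[of r "card X"] assms by (simp add: algebra_simps)
  finally show ?thesis unfolding block_def by (intro less_mult_imp_div_less) (simp add: mult.commute)
qed

text \<open>With K points in at most 2r - 1 cells, Cauchy-Schwarz gives at least K^2 / (2r - 1)
  pairs in a common cell. As K >= 2 (2r - 1), this is at least 2K; removing the K diagonal pairs
  leaves K >= k.\<close>

lemma card_same_cell_ge: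
  assumes fin: "finite X" "finite Y" and "m \<noteq> 0" and "r > 0" and k: "incidences X Y (m, c) \<ge> k" "k \<ge> 4 * r - 2"
  defines "cx \<equiv> block X (card X div r + 1)" and "cy \<equiv> block Y (card Y div r + 1)"
  shows "k \<le> card {(x, x'). x \<in> X \<and> x' \<in> X \<and> m * x + c \<in> Y \<and> m * x' + c \<in> Y \<and> x \<noteq> x' \<and>
      cx x = cx x' \<and> cy (m * x + c) = cy (m * x' + c)}" (is "_ \<le> card ?P")
proof -
  define S where "S = {x\<in>X. m * x + c \<in> Y}"
  \<comment> \<open>\<open>f\<close> numbers the cells along the line. The block indices move in the
    same direction if m > 0 and in opposite ones if m < 0, where the second is reversed; so both
    summands are monotone in x, and equal values of \<open>f\<close> mean equal cells.\<close>
  define f where "f x = (if m > 0 then cx x + cy (m * x + c) else cx x + (r - 1 - cy (m * x + c)))" for x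
  have fS: "finite S" unfolding S_def using fin by auto
  have cx: "cx x < r" and cy: "cy (m * x + c) < r" if "x \<in> S" for x
    using block_less[OF fin(1) _ \<open>r > 0\<close>] block_less[OF fin(2) _ \<open>r > 0\<close>] that
    unfolding S_def cx_def cy_def by auto
  have "f x < 2 * r - 1" if "x \<in> S" for x
  proof (cases "m > 0")
    case True
    hence "f x = cx x + cy (m * x + c)" unfolding f_def by simp
    thus ?thesis using cx[OF that] cy[OF that] by linarith
  next
    case False
    hence "f x = cx x + (r - 1 - cy (m * x + c))" unfolding f_def by simp
    thus ?thesis using cx[OF that] cy[OF that] by linarith
  qed
  hence "f ` S \<subseteq> {..<2 * r - 1}" by auto
  hence "card (f ` S) \<le> 2 * r - 1" using card_mono[OF _ \<open>f ` S \<subseteq> _\<close>] by simp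
  have cell: "cx x = cx y \<and> cy (m * x + c) = cy (m * y + c)"
    if "f x = f y" "x \<in> S" "y \<in> S" "x \<le> y" for x y
  proof -
    have 1: "cx x \<le> cx y" unfolding cx_def using that fin by (intro block_mono)
    have 2: "m > 0 \<Longrightarrow> cy (m * x + c) \<le> cy (m * y + c)"
      unfolding cy_def using that fin by (intro block_mono) auto
    have 3: "m < 0 \<Longrightarrow> cy (m * y + c) \<le> cy (m * x + c)"
      unfolding cy_def using that fin by (intro block_mono) auto
    show ?thesis
    proof (cases "m > 0")
      case True
      hence "cx x + cy (m * x + c) = cx y + cy (m * y + c)" using \<open>f x = f y\<close> unfolding f_def by simp
      thus ?thesis using 1 2[OF True] by linarith
    next
      case False
      hence "cx x + (r - 1 - cy (m * x + c)) = cx y + (r - 1 - cy (m * y + c))"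
        using \<open>f x = f y\<close> unfolding f_def by simp
      moreover have "cy (m * y + c) \<le> cy (m * x + c)" using 3 False \<open>m \<noteq> 0\<close> by simp
      ultimately show ?thesis using 1 cy[OF that(2)] cy[OF that(3)] by linarith
    qed
  qed
  let ?C = "{(x, y). x \<in> S \<and> y \<in> S \<and> f x = f y}"
  have fC: "finite ?C" by (rule finite_subset[of _ "S \<times> S"]) (use fS in auto)
  have fP: "finite ?P" by (rule finite_subset[of _ "X \<times> X"]) (use fin in auto)
  have "?C \<subseteq> ?P \<union> (\<lambda>x. (x, x)) ` S"
  proof
    fix p assume "p \<in> ?C"
    then obtain x y where p: "p = (x, y)" "x \<in> S" "y \<in> S" "f x = f y" by auto
    have "cx x = cx y \<and> cy (m * x + c) = cy (m * y + c)"
    proof (cases "x \<le> y")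
      case True
      show ?thesis by (rule cell[OF p(4,2,3) True])
    next
      case False
      thus ?thesis using cell[OF p(4)[symmetric] p(3,2)] by simp
    qed
    thus "p \<in> ?P \<union> (\<lambda>x. (x, x)) ` S" using p unfolding S_def by auto
  qed
  hence "card ?C \<le> card (?P \<union> (\<lambda>x. (x, x)) ` S)" using fP fS by (intro card_mono) auto
  also have "\<dots> \<le> card ?P + card S"
    by (rule order.trans[OF card_Un_le]) (simp add: card_image_le[OF fS])
  finally have C: "card ?C \<le> card ?P + card S" .
  have cS: "card S = incidences X Y (m, c)" unfolding incidences_def S_def by simp
  have "real (card S) ^ 2 \<le> real (card (f ` S)) * real (card ?C)" by (rule card_collisions[OF fS])
  also have "\<dots> \<le> real (2 * r - 1) * real (card ?P + card S)"
    using \<open>card (f ` S) \<le> _\<close> C by (intro mult_mono) auto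
  finally have "card S * card S \<le> (2 * r - 1) * (card ?P + card S)"
    unfolding power2_eq_square of_nat_mult[symmetric] by (simp only: of_nat_le_iff)
  moreover have "2 * (2 * r - 1) * card S \<le> card S * card S"
    using k cS by (intro mult_right_mono) auto
  moreover have "(2 * r - 1) * (2 * card S) = 2 * (2 * r - 1) * card S" by (simp only: mult_ac)
  ultimately have "(2 * r - 1) * (2 * card S) \<le> (2 * r - 1) * (card ?P + card S)" by linarith
  hence "2 * card S \<le> card ?P + card S" using \<open>r > 0\<close> by simp
  thus ?thesis using k cS by simp
qed

text \<open>
  Cartesian products need neither crossing numbers nor cuttings: a line that is not parallel to an
  axis is monotone, so it meets at most \<open>2 * r - 1\<close> of the \<open>r * r\<close> cells into which \<open>X \<times> Y\<close>
  is cut, and hence has many pairs of points inside single cells.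
\<close>

lemma szemeredi_trotter_grid:
  assumes fin: "finite X" "finite Y" "finite L" and nz: "\<And>l. l \<in> L \<Longrightarrow> fst l \<noteq> 0"
    and rich: "\<And>l. l \<in> L \<Longrightarrow> incidences X Y l \<ge> k" and "k \<ge> 2"
  shows "real (card L) * real k ^ 3 \<le> 256 * (real (card X) * real (card Y))^2"
proof (cases "L = {}")
  case False
  \<comment> \<open>The largest r with 4r - 2 <= k; it is positive and comparable with k because k
    >= 2.\<close>
  define r where "r = (k + 2) div 4"
  have r: "r > 0" "4 * r - 2 \<le> k" "k \<le> 8 * r" using \<open>k \<ge> 2\<close> unfolding r_def by linarith+
  define wx where "wx = card X div r + 1"
  define wy where "wy = card Y div r + 1"
  define P where "P = (\<lambda>(m, c). {(x, x'). x \<in> X \<and> x' \<in> X \<and> m * x + c \<in> Y \<and> m * x' + c \<in> Y \<and> x \<noteq> x' \<and>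
      block X wx x = block X wx x' \<and> block Y wy (m * x + c) = block Y wy (m * x' + c)})"
  define Q where "Q = (SIGMA (x, y) : X \<times> Y. {x'\<in>X. block X wx x' = block X wx x} \<times> {y'\<in>Y. block Y wy y' = block Y wy y})"
  \<comment> \<open>A non-horizontal line meets the grid in at most \<open>card X\<close> and at
    most \<open>card Y\<close> points. The resulting bounds on k make the \<open>+ 1\<close> in the
    block lengths cost only a factor 2.\<close>
  obtain m c where mc: "(m, c) \<in> L" using False by auto
  have "k \<le> incidences X Y (m, c)" using rich mc by auto
  also have "\<dots> \<le> card X" unfolding incidences_def using fin by (auto intro: card_mono)
  finally have kX: "k \<le> card X" .
  have "k \<le> incidences X Y (m, c)" using rich mc by auto
  also have "\<dots> = card ((\<lambda>x. m * x + c) ` {x\<in>X. m * x + c \<in> Y})"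
    unfolding incidences_def using nz[OF mc] by (simp add: card_image inj_on_def)
  also have "\<dots> \<le> card Y" using fin by (auto intro: card_mono)
  finally have kY: "k \<le> card Y" .
  have fQ: "finite Q" unfolding Q_def using fin by auto
  \<comment> \<open>Two distinct points determine their line, so all pairs found on all lines inject
    into \<open>Q\<close>, the pairs of grid points in a common cell.\<close>
  define g where "g = (\<lambda>((m, c), (x, x')). ((x, m * x + c :: real), (x', m * x' + c)))"
  have fP: "finite (P l)" for l
    by (rule finite_subset[of _ "X \<times> X"]) (use fin in \<open>auto simp: P_def split: prod.splits\<close>)
  have "card L * k = (\<Sum>l\<in>L. k)" by simp
  also have "\<dots> \<le> (\<Sum>l\<in>L. card (P l))"
  proof (rule sum_mono)
    fix l assume l: "l \<in> L"
    obtain m c where mc: "l = (m, c)" by (cases l)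
    show "k \<le> card (P l)"
      using card_same_cell_ge[OF fin(1,2) _ r(1), of m k c] nz[OF l] rich[OF l] r
      unfolding mc P_def wx_def wy_def by simp
  qed
  also have "\<dots> = card (SIGMA l : L. P l)" using fin fP by simp
  also have "\<dots> = card (g ` (SIGMA l : L. P l))"
  proof (rule card_image[symmetric], rule inj_onI)
    fix u v assume u: "u \<in> (SIGMA l : L. P l)" and v: "v \<in> (SIGMA l : L. P l)" and eq: "g u = g v"
    obtain m c x x' where U: "u = ((m, c), (x, x'))" by (metis surj_pair)
    obtain m2 c2 x2 x2' where V: "v = ((m2, c2), (x2, x2'))" by (metis surj_pair)
    have e: "x2 = x" "x2' = x'" "m * x + c = m2 * x + c2" "m * x' + c = m2 * x' + c2"
      using eq unfolding U V g_def by auto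
    have "x \<noteq> x'" using u unfolding U P_def by auto
    have "(m - m2) * (x - x') = 0" using e(3,4) by (simp add: algebra_simps)
    hence "m = m2" using \<open>x \<noteq> x'\<close> by simp
    thus "u = v" using e unfolding U V by simp
  qed
  also have "\<dots> \<le> card Q"
    by (intro card_mono[OF fQ]) (auto simp: g_def P_def Q_def)
  also have "card Q = (\<Sum>p\<in>X \<times> Y. card {x'\<in>X. block X wx x' = block X wx (fst p)} *
      card {y'\<in>Y. block Y wy y' = block Y wy (snd p)})"
    unfolding Q_def using fin by (subst card_SigmaI) (auto simp: card_cartesian_product intro!: sum.cong)
  also have "\<dots> \<le> (\<Sum>p\<in>X \<times> Y. wx * wy)"
    by (intro sum_mono mult_mono card_block_le fin) (auto simp: wx_def wy_def)
  finally have main: "card L * k \<le> card X * card Y * (wx * wy)" by (simp add: card_cartesian_product)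
  have w: "r * (n div r + 1) \<le> 2 * n" if "k \<le> n" for n
  proof -
    have "r * (n div r) \<le> n" by simp
    moreover have "r \<le> n" using that r \<open>k \<ge> 2\<close> by linarith
    ultimately show ?thesis unfolding distrib_left mult_1_right by linarith
  qed
  have "card L * k ^ 3 = card L * k * (k * k)" by (simp add: power3_eq_cube)
  also have "\<dots> \<le> card X * card Y * (wx * wy) * ((8 * r) * (8 * r))"
    by (rule mult_mono[OF main mult_mono[OF r(3) r(3)]]) auto
  also have "\<dots> = 64 * (card X * card Y) * ((r * wx) * (r * wy))" by (simp add: algebra_simps)
  also have "\<dots> \<le> 64 * (card X * card Y) * ((2 * card X) * (2 * card Y))"
    unfolding wx_def wy_def by (rule mult_left_mono[OF mult_mono[OF w[OF kX] w[OF kY]]]) auto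
  also have "\<dots> = 256 * (card X * card Y)^2" by (simp add: power2_eq_square)
  finally have "real (card L * k ^ 3) \<le> real (256 * (card X * card Y)^2)" by (simp only: of_nat_le_iff)
  thus ?thesis by simp
qed simp

text \<open>Lines meeting the grid once escape the Szemeredi--Trotter bound, so the number of lines
  that meet it is kept for the caller to estimate; 768 = 3 * 256.\<close>

lemma sum_incidences_cubed_le:
  assumes fin: "finite X" "finite Y" "finite L" and nz: "\<And>l. l \<in> L \<Longrightarrow> fst l \<noteq> 0"
    and "card X \<le> R"
  shows "(\<Sum>l\<in>L. real (incidences X Y l) ^ 3) \<le>
    real (card {l\<in>L. incidences X Y l \<ge> 1}) + 768 * harm R * (real (card X) * real (card Y))^2"
proof -
  have "(\<Sum>l\<in>L. real (incidences X Y l) ^ 3) \<le> real (card {l\<in>L. 1 \<le> incidences X Y l}) +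
      3 * (256 * (real (card X) * real (card Y))^2) * harm R"
  proof (rule sum_cubes_le_harm[OF fin(3)])
    fix l assume "l \<in> L"
    have "incidences X Y l \<le> card X"
      unfolding incidences_def using fin by (auto intro: card_mono split: prod.splits)
    thus "incidences X Y l \<le> R" using assms by simp
  next
    fix k :: nat assume "2 \<le> k"
    thus "real (card {l\<in>L. k \<le> incidences X Y l}) * real k ^ 3 \<le> 256 * (real (card X) * real (card Y))^2"
      using fin nz by (intro szemeredi_trotter_grid) auto
  qed auto
  thus ?thesis by (simp add: mult_ac)
qed

section \<open>Sums along lines through the origin\<close>

text \<open>\<open>F l\<close> lists the abscissae of points (x, l * x) on the line of slope
  \<open>l\<close>; vector sums of points on two such lines are formed.\<close>

definition line_sums :: "(real \<Rightarrow> real set) \<Rightarrow> real \<Rightarrow> real \<Rightarrow> (real \<times> real) set" where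
  "line_sums F l u = (\<lambda>(x, y). (x + y, l * x + u * y)) ` (F l \<times> F u)"

text \<open>The directions (1, l) and (1, u) are linearly independent.\<close>

lemma inj_line_sum: "l \<noteq> u \<Longrightarrow> inj_on (\<lambda>(x, y). (x + y, l * x + u * y)) (V :: (real \<times> real) set)"
proof (rule inj_onI, clarsimp)
  fix x y x' y' :: real
  assume "l \<noteq> u" and s: "x + y = x' + y'" and t: "l * x + u * y = l * x' + u * y'"
  have "(l - u) * (x - x') = (l * x + u * y) - (l * x' + u * y') - u * ((x + y) - (x' + y'))"
    by (simp add: algebra_simps)
  also have "\<dots> = 0" using s t by simp
  finally have "x = x'" using \<open>l \<noteq> u\<close> by simp
  thus "x = x' \<and> y = y'" using s by simp
qed

lemma card_line_sums: "l \<noteq> u \<Longrightarrow> card (line_sums F l u) = card (F l) * card (F u)"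
  unfolding line_sums_def by (simp add: card_image[OF inj_line_sum] card_cartesian_product)

text \<open>A sum of positive multiples of (1, l) and (1, u) lies strictly inside the sector between
  the two lines. Non-overlapping sectors then give disjoint sums.\<close>

lemma line_sums_slope:
  assumes "p \<in> line_sums F l u" "l < u" "\<And>x. x \<in> F l \<union> F u \<Longrightarrow> x > 0"
  shows "fst p > 0" "l * fst p < snd p" "snd p < u * fst p"
proof -
  obtain x y where p: "p = (x + y, l * x + u * y)" "x \<in> F l" "y \<in> F u"
    using assms(1) unfolding line_sums_def by auto
  have xy: "x > 0" "y > 0" using assms(3) p by auto
  hence "l * y < u * y" "l * x < u * x" using \<open>l < u\<close> by (auto intro: mult_strict_right_mono)
  thus "fst p > 0" "l * fst p < snd p" "snd p < u * fst p" using xy p by (auto simp: algebra_simps)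
qed

lemma line_sums_disjoint:
  assumes "l < u" "u \<le> l'" "l' < u'" "\<And>x. x \<in> F l \<union> F u \<union> F l' \<union> F u' \<Longrightarrow> x > 0"
  shows "line_sums F l u \<inter> line_sums F l' u' = {}"
proof (rule ccontr)
  assume "line_sums F l u \<inter> line_sums F l' u' \<noteq> {}"
  then obtain p where p: "p \<in> line_sums F l u" "p \<in> line_sums F l' u'" by auto
  have "u * fst p \<le> l' * fst p"
    using line_sums_slope(1)[OF p(1) assms(1)] assms by (intro mult_right_mono) auto
  thus False
    using line_sums_slope(3)[OF p(1) assms(1)] line_sums_slope(2)[OF p(2) assms(3)] assms(4) by force
qed

text \<open>
  A point shared by \<open>line_sums F i j\<close> and \<open>line_sums F k l\<close> satisfies \<open>x + y = z + w\<close> and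
  \<open>i * x + j * y = k * z + l * w\<close>; eliminating \<open>w\<close>, or \<open>z\<close> if \<open>j = l\<close>, leaves one linear equation.
\<close>

lemma line_sums_coincidence:
  assumes S: "i \<in> S" "j \<in> S" "k \<in> S" "l \<in> S" and lt: "i < j" "i < l" "k < j" "k < l"
    and ne: "(i, j) \<noteq> (k, l)" and fin: "finite (F i)" "finite (F j)"
    and nc: "\<And>l u v a b c. l \<in> S \<Longrightarrow> u \<in> S \<Longrightarrow> v \<in> S \<Longrightarrow> a \<noteq> 0 \<Longrightarrow> b \<noteq> 0 \<Longrightarrow> c \<noteq> 0 \<Longrightarrow>
      card {(x, y). x \<in> F l \<and> y \<in> F u \<and> (\<exists>z\<in>F v. a * x + b * y = c * z)} \<le> N"
  shows "card (line_sums F i j \<inter> line_sums F k l) \<le> N"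
proof -
  obtain v a b c where v: "v \<in> S" "a \<noteq> 0" "b \<noteq> 0" "c \<noteq> 0" and
    eq: "\<And>x y z w. z \<in> F k \<Longrightarrow> w \<in> F l \<Longrightarrow> x + y = z + w \<Longrightarrow> i * x + j * y = k * z + l * w \<Longrightarrow>
      \<exists>t\<in>F v. a * x + b * y = c * t"
  proof (cases "j = l")
    case False
    show thesis
    proof (rule that[of k "l - i" "l - j" "l - k"])
      fix x y z w assume "z \<in> F k" and e: "x + y = z + w" "i * x + j * y = k * z + l * w"
      have "(l - i) * x + (l - j) * y = l * (x + y) - (i * x + j * y)" by (simp add: algebra_simps)
      also have "\<dots> = (l - k) * z" unfolding e by (simp add: algebra_simps)
      finally show "\<exists>t\<in>F k. (l - i) * x + (l - j) * y = (l - k) * t" using \<open>z \<in> F k\<close> by auto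
    qed (use S lt False in auto)
  next
    case True
    \<comment> \<open>Here the second slopes agree, so the pairs can differ only in the first: i - k
      is nonzero.\<close>
    show thesis
    proof (rule that[of l "i - k" "j - k" "l - k"])
      fix x y z w assume "w \<in> F l" and e: "x + y = z + w" "i * x + j * y = k * z + l * w"
      have "(i - k) * x + (j - k) * y = (i * x + j * y) - k * (x + y)" by (simp add: algebra_simps)
      also have "\<dots> = (l - k) * w" unfolding e by (simp add: algebra_simps)
      finally show "\<exists>t\<in>F l. (i - k) * x + (j - k) * y = (l - k) * t" using \<open>w \<in> F l\<close> by auto
    qed (use S lt True ne in auto)
  qed
  let ?T = "{(x, y). x \<in> F i \<and> y \<in> F j \<and> (\<exists>t\<in>F v. a * x + b * y = c * t)}"
  have fT: "finite ?T" by (rule finite_subset[of _ "F i \<times> F j"]) (use fin in auto)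
  have "line_sums F i j \<inter> line_sums F k l \<subseteq> (\<lambda>(x, y). (x + y, i * x + j * y)) ` ?T"
  proof
    fix p assume "p \<in> line_sums F i j \<inter> line_sums F k l"
    hence "p \<in> line_sums F i j" "p \<in> line_sums F k l" by simp_all
    from this(1) obtain x y where p: "p = (x + y, i * x + j * y)" "x \<in> F i" "y \<in> F j"
      unfolding line_sums_def by auto
    from \<open>p \<in> line_sums F k l\<close> obtain z w where zw: "p = (z + w, k * z + l * w)" "z \<in> F k" "w \<in> F l"
      unfolding line_sums_def by auto
    have "x + y = z + w" "i * x + j * y = k * z + l * w" using p(1) zw(1) by simp_all
    hence "(x, y) \<in> ?T" using eq[OF zw(2,3)] p(2,3) by simp
    thus "p \<in> (\<lambda>(x, y). (x + y, i * x + j * y)) ` ?T" using p(1) by (intro image_eqI[of _ _ "(x, y)"]) auto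
  qed
  hence "card (line_sums F i j \<inter> line_sums F k l) \<le> card ?T"
    using fT by (meson card_image_le card_mono finite_imageI order.trans)
  also have "\<dots> \<le> N" by (rule nc[OF S(1,2) v(1-4)])
  finally show ?thesis .
qed

text \<open>
  Solymosi's argument, with sums taken between all lines of a block of \<open>2 * m\<close> consecutive slopes
  (Konyagin and Shkredov): unless two such pairs of lines have many sums in common, a factor \<open>m\<close>
  is gained.
\<close>

lemma slopes_bound:
  fixes A S :: "real set" and F :: "real \<Rightarrow> real set" and m \<tau> :: nat
  assumes A: "finite A" "A \<subseteq> {0<..}" and S: "finite S" and "m > 0"
    and F: "\<And>l. l \<in> S \<Longrightarrow> F l \<subseteq> {a\<in>A. l * a \<in> A}" "\<And>l. l \<in> S \<Longrightarrow> card (F l) = \<tau>"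
    and nc: "\<And>l u v a b c. m > 1 \<Longrightarrow> l \<in> S \<Longrightarrow> u \<in> S \<Longrightarrow> v \<in> S \<Longrightarrow> a \<noteq> 0 \<Longrightarrow> b \<noteq> 0 \<Longrightarrow> c \<noteq> 0 \<Longrightarrow>
      2 * m^2 * card {(x, y). x \<in> F l \<and> y \<in> F u \<and> (\<exists>z\<in>F v. a * x + b * y = c * z)} \<le> \<tau>^2"
  shows "(card S div (2 * m)) * m^2 * \<tau>^2 \<le> 2 * card (A + A)^2"
proof -
  define g where "g i = sorted_list_of_set S ! i" for i
  have g_less: "g i < g j" if "i < j" "j < card S" for i j
    unfolding g_def using sorted_wrt_nth_less[OF strict_sorted_list_of_set, of i j S] that by simp
  have g_le: "g i \<le> g j" if "i \<le> j" "j < card S" for i j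
    using g_less[of i j] that by (cases "i = j") auto
  have gS: "g i \<in> S" if "i < card S" for i
    using nth_mem[of i "sorted_list_of_set S"] S that unfolding g_def by simp
  \<comment> \<open>There are \<open>q\<close> full blocks of 2m slopes. \<open>i\<close> picks from
    the lower half and \<open>j\<close> from the upper half, so within a block every first slope is
    below every second one, as \<open>line_sums_coincidence\<close> demands.\<close>
  define q where "q = card S div (2 * m)"
  define E where "E = {..<q} \<times> {..<m} \<times> {..<m}"
  define i :: "nat \<times> nat \<times> nat \<Rightarrow> nat" where "i = (\<lambda>(p, u, v). 2 * m * p + u)"
  define j :: "nat \<times> nat \<times> nat \<Rightarrow> nat" where "j = (\<lambda>(p, u, v). 2 * m * p + m + v)"
  define X where "X e = line_sums F (g (i e)) (g (j e))" for e
  \<comment> \<open>The sums belonging to the pair \<open>e\<close> alone; these sets are disjoint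
    by construction.\<close>
  define Y where "Y e = X e - (\<Union>f\<in>E - {e}. X f)" for e
  have ij: "i e < j f" "j f < card S" "i e < card S" if "e \<in> E" "f \<in> E" "fst e = fst f" for e f
  proof -
    from \<open>fst e = fst f\<close> obtain p u v u' v' where e: "e = (p, u, v)" "f = (p, u', v')"
      by (cases e, cases f) auto
    have "2 * m * (p + 1) \<le> 2 * m * q" using that e unfolding E_def by (intro mult_left_mono) auto
    also have "\<dots> \<le> card S" unfolding q_def by simp
    finally show "i e < j f" "j f < card S" "i e < card S"
      using that e unfolding E_def i_def j_def by auto
  qed
  have pos: "x > 0" if "l \<in> S" "x \<in> F l" for l x using F(1)[OF that(1)] that(2) A by auto
  have finF: "finite (F l)" if "l \<in> S" for l using F(1)[OF that] A by (auto intro: finite_subset)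
  have gE: "g (i e) \<in> S" "g (j e) \<in> S" "g (i e) < g (j e)" if "e \<in> E" for e
    using ij[OF that that refl] by (auto intro: gS g_less)
  have disj: "X e \<inter> X f = {}" if "e \<in> E" "f \<in> E" "fst e < fst f" for e f
  proof -
    obtain p u v p' u' v' where e: "e = (p, u, v)" "f = (p', u', v')" by (cases e, cases f) auto
    have "2 * m * (p + 1) \<le> 2 * m * p'" using that e by (intro mult_left_mono) auto
    hence "j e \<le> i f" using that e unfolding E_def i_def j_def by auto
    thus ?thesis unfolding X_def using gE[OF that(1)] gE[OF that(2)] ij[OF that(2,2)] pos
      by (intro line_sums_disjoint) (auto intro: g_le)
  qed
  have coinc: "2 * m^2 * card (X e \<inter> X f) \<le> \<tau>^2" if "e \<in> E" "f \<in> E" "e \<noteq> f" "fst e = fst f" for e f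
  proof -
    \<comment> \<open>For m = 1 a block holds a single pair, so two distinct pairs in one block
      force m > 1.\<close>
    have m1: "m > 1"
    proof (rule ccontr)
      assume "\<not> m > 1"
      hence "m = 1" using \<open>m > 0\<close> by simp
      thus False using that unfolding E_def by auto
    qed
    from \<open>fst e = fst f\<close> obtain p u v u' v' where e: "e = (p, u, v)" "f = (p, u', v')"
      by (cases e, cases f) auto
    have lt: "i e < j e" "i e < j f" "i f < j e" "i f < j f" "i e < card S" "i f < card S"
      "j e < card S" "j f < card S" using ij that by auto
    have inj: "a = b" if "g a = g b" "a < card S" "b < card S" for a b
      using g_less[of a b] g_less[of b a] that by (metis less_irrefl linorder_less_linear)
    have ne: "(g (i e), g (j e)) \<noteq> (g (i f), g (j f))"
    proof
      assume "(g (i e), g (j e)) = (g (i f), g (j f))"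
      hence "i e = i f" "j e = j f" using inj lt by auto
      thus False using e that unfolding i_def j_def by auto
    qed
    have "card (X e \<inter> X f) \<le> \<tau>^2 div (2 * m^2)" unfolding X_def
    proof (rule line_sums_coincidence[where S = S])
      fix l u v a b c :: real
      assume "l \<in> S" "u \<in> S" "v \<in> S" "a \<noteq> 0" "b \<noteq> 0" "c \<noteq> 0"
      from nc[OF m1 this]
      show "card {(x, y). x \<in> F l \<and> y \<in> F u \<and> (\<exists>z\<in>F v. a * x + b * y = c * z)} \<le> \<tau>\<^sup>2 div (2 * m\<^sup>2)"
        using \<open>m > 0\<close> by (simp add: less_eq_div_iff_mult_less_eq mult.commute)
    qed (use lt gS ne finF g_less in auto)
    thus ?thesis using \<open>m > 0\<close> by (simp add: less_eq_div_iff_mult_less_eq mult.commute)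
  qed
  have finX: "finite (X e)" if "e \<in> E" for e
    unfolding X_def line_sums_def using gE[OF that] finF by auto
  have cardE: "card E = q * m^2" unfolding E_def by (simp add: card_cartesian_product power2_eq_square)
  have finE: "finite E" unfolding E_def by simp
  have Y_ge: "\<tau>^2 \<le> 2 * card (Y e)" if e: "e \<in> E" for e
  proof -
    \<comment> \<open>Only pairs of the same block can meet \<open>X e\<close>. There are at most
      m^2 of them, each sharing at most \<tau>^2 / (2 m^2) sums, so at least half of
      \<open>X e\<close> survives in \<open>Y e\<close>.\<close>
    define B where "B = {f\<in>E. f \<noteq> e \<and> fst f = fst e}"
    define U where "U = X e \<inter> (\<Union>f\<in>E - {e}. X f)"
    have "B \<subseteq> {fst e} \<times> {..<m} \<times> {..<m}" unfolding B_def E_def by auto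
    hence "card B \<le> card ({fst e} \<times> {..<m} \<times> {..<m})" by (intro card_mono) auto
    hence cB: "card B \<le> m^2" by (simp add: card_cartesian_product power2_eq_square)
    have finB: "finite B" unfolding B_def using finE by simp
    have "U \<subseteq> (\<Union>f\<in>B. X e \<inter> X f)"
    proof
      fix x assume "x \<in> U"
      then obtain f where f: "f \<in> E" "f \<noteq> e" "x \<in> X e" "x \<in> X f" unfolding U_def by auto
      have "fst f = fst e" using disj[OF e f(1)] disj[OF f(1) e] f by (metis IntI empty_iff linorder_neqE_nat)
      hence "f \<in> B" using f unfolding B_def by simp
      thus "x \<in> (\<Union>f\<in>B. X e \<inter> X f)" using f by blast
    qed
    hence "card U \<le> card (\<Union>f\<in>B. X e \<inter> X f)" using finB finX[OF e] by (intro card_mono) auto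
    also have "\<dots> \<le> (\<Sum>f\<in>B. card (X e \<inter> X f))" by (rule card_UN_le[OF finB])
    finally have "2 * m^2 * card U \<le> 2 * m^2 * (\<Sum>f\<in>B. card (X e \<inter> X f))" by (rule mult_left_mono) simp
    also have "\<dots> = (\<Sum>f\<in>B. 2 * m^2 * card (X e \<inter> X f))" by (rule sum_distrib_left)
    also have "\<dots> \<le> (\<Sum>f\<in>B. \<tau>^2)" 
    proof (rule sum_mono)
      fix f assume "f \<in> B"
      hence "f \<in> E" "e \<noteq> f" "fst e = fst f" unfolding B_def by auto
      thus "2 * m^2 * card (X e \<inter> X f) \<le> \<tau>^2" by (rule coinc[OF e])
    qed
    also have "\<dots> \<le> m^2 * \<tau>^2" using cB by simp
    finally have "m^2 * (2 * card U) \<le> m^2 * \<tau>^2" by (simp add: mult_ac)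
    hence "2 * card U \<le> \<tau>^2" using \<open>m > 0\<close> by simp
    moreover have "card (X e) = \<tau>^2"
      unfolding X_def using gE[OF e] F(2) by (subst card_line_sums) (auto simp: power2_eq_square)
    moreover have "card (Y e) = card (X e) - card U"
    proof -
      have "Y e = X e - U" unfolding Y_def U_def by auto
      thus ?thesis using finX[OF e] by (simp add: card_Diff_subset U_def)
    qed
    ultimately show ?thesis by linarith
  qed
  have "q * m^2 * \<tau>^2 = (\<Sum>e\<in>E. \<tau>^2)" by (simp add: cardE)
  also have "\<dots> \<le> (\<Sum>e\<in>E. 2 * card (Y e))" by (rule sum_mono) (rule Y_ge)
  also have "\<dots> = 2 * card (\<Union>e\<in>E. Y e)"
  proof -
    have "card (\<Union>e\<in>E. Y e) = (\<Sum>e\<in>E. card (Y e))"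
      by (rule card_UN_disjoint[OF finE]) (use finX in \<open>auto simp: Y_def\<close>)
    thus ?thesis by (simp add: sum_distrib_left)
  qed
  also have "\<dots> \<le> 2 * card ((A + A) \<times> (A + A))"
  proof -
    have "X e \<subseteq> (A + A) \<times> (A + A)" if "e \<in> E" for e
      unfolding X_def line_sums_def using F(1)[OF gE(1)[OF that]] F(1)[OF gE(2)[OF that]]
      by (auto intro!: set_plus_intro)
    hence "(\<Union>e\<in>E. Y e) \<subseteq> (A + A) \<times> (A + A)" unfolding Y_def by blast
    thus ?thesis using A by (intro mult_left_mono card_mono) (auto simp: finite_set_plus)
  qed
  finally show ?thesis unfolding q_def by (simp add: card_cartesian_product power2_eq_square)
qed

text \<open>If 0 is not in \<open>A\<close>, this counts the representations of \<open>t\<close> as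
  a quotient of elements of \<open>A\<close>; its second moment over all quotients is the
  multiplicative energy.\<close>

definition dilate_reps :: "real set \<Rightarrow> real \<Rightarrow> nat" where
  "dilate_reps A t = card {a\<in>A. t * a \<in> A}"

lemma card_le_sumset:
  assumes "finite (A :: real set)" "A \<noteq> {}"
  shows "card A \<le> card (A + A)"
proof -
  obtain a where a: "a \<in> A" using assms by auto
  have "card A = card ((\<lambda>x. x + a) ` A)" by (simp add: card_image)
  also have "\<dots> \<le> card (A + A)"
    using assms a by (intro card_mono) (auto simp: finite_set_plus intro!: set_plus_intro)
  finally show ?thesis .
qed

text \<open>The case m = 1 of \<open>slopes_bound\<close>: neighbouring slopes are paired
  off.\<close>

lemma solymosi_level:
  assumes A: "finite A" "A \<subseteq> {0<..}" and S: "finite S" and r: "\<And>t. t \<in> S \<Longrightarrow> k \<le> dilate_reps A t"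
  shows "card S * k^2 \<le> 6 * card (A + A)^2"
proof -
  have "\<exists>B\<subseteq>{a\<in>A. t * a \<in> A}. card B = k" if "t \<in> S" for t
    using r[OF that] obtain_subset_with_card_n[of k "{a\<in>A. t * a \<in> A}"] unfolding dilate_reps_def by metis
  then obtain F where F: "\<And>t. t \<in> S \<Longrightarrow> F t \<subseteq> {a\<in>A. t * a \<in> A}" "\<And>t. t \<in> S \<Longrightarrow> card (F t) = k" by metis
  have 1: "(card S div (2 * 1)) * 1^2 * k^2 \<le> 2 * card (A + A)^2"
    by (rule slopes_bound[OF A S _ F]) auto
  \<comment> \<open>Rounding down loses a factor at most 3 from two slopes on, whence 6 = 3 * 2; a
    single slope has k <= |A| <= |A + A|.\<close>
  consider "card S = 0" | "card S = 1" | "card S \<ge> 2" by linarith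
  then show ?thesis
  proof cases
    case 2
    then obtain t where "t \<in> S" by fastforce
    have "A \<noteq> {} \<or> k = 0" using r[OF \<open>t \<in> S\<close>] unfolding dilate_reps_def by auto
    moreover have "k \<le> card A"
      using r[OF \<open>t \<in> S\<close>] card_mono[OF A(1), of "{a\<in>A. t * a \<in> A}"] unfolding dilate_reps_def by simp
    ultimately have "k \<le> card (A + A)" using card_le_sumset[OF A(1)] by (meson le0 order.trans)
    hence "k^2 \<le> card (A + A)^2" by (rule power_mono) simp
    thus ?thesis unfolding 2 by linarith
  next
    case 3
    hence "card S \<le> 3 * (card S div 2)" by linarith
    hence "card S * k^2 \<le> 3 * (card S div 2) * k^2" by (rule mult_right_mono) simp
    also have "\<dots> = 3 * ((card S div (2 * 1)) * 1^2 * k^2)" by simp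
    finally show ?thesis using 1 by linarith
  qed simp
qed

section \<open>Multiplicative energy\<close>

lemma dilate_energy_le:
  assumes A: "finite A" "A \<subseteq> {0<..}" and T: "finite T" and "card A \<le> R"
  shows "(\<Sum>t\<in>T. real (dilate_reps A t) ^ 2) \<le> 12 * real (card (A + A))^2 * harm R"
proof -
  have "(\<Sum>t\<in>T. real (dilate_reps A t) ^ 2) \<le> 2 * (6 * real (card (A + A))^2) * harm R"
  proof (rule sum_squares_le_harm[OF T])
    fix t
    show "dilate_reps A t \<le> R"
      using card_mono[OF A(1), of "{a\<in>A. t * a \<in> A}"] assms(4) unfolding dilate_reps_def by simp
  next
    fix k :: nat
    have "card {t\<in>T. k \<le> dilate_reps A t} * k^2 \<le> 6 * card (A + A)^2"
      by (rule solymosi_level[OF A]) (use T in auto)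
    hence "real (card {t\<in>T. k \<le> dilate_reps A t} * k^2) \<le> real (6 * card (A + A)^2)"
      by (simp only: of_nat_le_iff)
    thus "real (card {t\<in>T. k \<le> dilate_reps A t}) * (real k)\<^sup>2 \<le> 6 * (real (card (A + A)))\<^sup>2" by simp
  qed
  thus ?thesis by simp
qed

text \<open>Each point of Q x Q lies on exactly one line of slope \<open>t\<close>, and
  \<open>C\<close> contains all the intercepts.\<close>

lemma sum_incidences:
  assumes "finite Q" "finite C" and "\<And>x y. x \<in> Q \<Longrightarrow> y \<in> Q \<Longrightarrow> y - t * x \<in> C"
  shows "(\<Sum>c\<in>C. incidences Q Q (t, c)) = card Q ^ 2"
proof -
  have "card (Q \<times> Q) = (\<Sum>c\<in>C. card {p\<in>Q \<times> Q. (\<lambda>(x, y). y - t * x) p = c})"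
    by (rule card_eq_sum_fibres) (use assms in auto)
  also have "\<dots> = (\<Sum>c\<in>C. incidences Q Q (t, c))"
  proof (rule sum.cong[OF refl])
    fix c
    have "{p\<in>Q \<times> Q. (\<lambda>(x, y). y - t * x) p = c} = (\<lambda>x. (x, t * x + c)) ` {x\<in>Q. t * x + c \<in> Q}"
      by (auto simp: algebra_simps)
    thus "card {p\<in>Q \<times> Q. (\<lambda>(x, y). y - t * x) p = c} = incidences Q Q (t, c)"
      unfolding incidences_def by (simp add: card_image inj_on_def)
  qed
  finally show ?thesis by (simp add: card_cartesian_product power2_eq_square)
qed

text \<open>Interpolates between the first moment, at most |S| \<tau>^2, and the third, at most
  \<tau>^4 up to a logarithm. Since |S| <= \<tau>^2, the lines met at all number at most \<tau>^4,
  which turns 768 into 769.\<close>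

lemma sum_incidences_squared_le:
  assumes Q: "finite Q" "card Q \<le> \<tau>" and S: "finite S" "0 \<notin> S" "card S \<le> \<tau>^2" and C: "finite C"
    and QC: "\<And>t x y. t \<in> S \<Longrightarrow> x \<in> Q \<Longrightarrow> y \<in> Q \<Longrightarrow> y - t * x \<in> C" and "\<tau> \<le> R" "R \<ge> 1"
  shows "(\<Sum>l\<in>S \<times> C. real (incidences Q Q l) ^ 2)^2 \<le> 769 * harm R * real (card S) * real \<tau> ^ 6"
proof -
  have h: "(1::real) \<le> harm R" by (rule harm_ge_1) fact
  have "(\<Sum>l\<in>S \<times> C. incidences Q Q l) = (\<Sum>t\<in>S. \<Sum>c\<in>C. incidences Q Q (t, c))"
    by (simp add: sum.cartesian_product)
  also have "\<dots> = (\<Sum>t\<in>S. card Q ^ 2)"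
    by (rule sum.cong[OF refl], rule sum_incidences) (use Q C QC in auto)
  also have "\<dots> \<le> card S * \<tau>^2" using Q by (auto intro: power_mono mult_left_mono)
  finally have s1: "(\<Sum>l\<in>S \<times> C. incidences Q Q l) \<le> card S * \<tau>^2" .
  have "card {l\<in>S \<times> C. incidences Q Q l \<ge> 1} = (\<Sum>l\<in>{l\<in>S \<times> C. incidences Q Q l \<ge> 1}. 1)" by simp
  also have "\<dots> \<le> (\<Sum>l\<in>S \<times> C. incidences Q Q l)"
    using S C by (intro order.trans[OF sum_mono sum_mono2]) auto
  also note s1
  finally have c1: "card {l\<in>S \<times> C. incidences Q Q l \<ge> 1} \<le> card S * \<tau>^2" .
  have "(\<Sum>l\<in>S \<times> C. real (incidences Q Q l) ^ 3) \<le>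
      real (card {l\<in>S \<times> C. incidences Q Q l \<ge> 1}) + 768 * harm R * (real (card Q) * real (card Q))^2"
    using Q S C \<open>\<tau> \<le> R\<close> by (intro sum_incidences_cubed_le) auto
  also have "\<dots> \<le> 1 * (real \<tau>^2 * real \<tau>^2) + 768 * harm R * (real \<tau> * real \<tau>)^2"
  proof (rule add_mono)
    have "card {l\<in>S \<times> C. incidences Q Q l \<ge> 1} \<le> \<tau>^2 * \<tau>^2"
      using c1 S(3) by (meson le_refl mult_le_mono order.trans)
    hence "real (card {l\<in>S \<times> C. incidences Q Q l \<ge> 1}) \<le> real (\<tau>^2 * \<tau>^2)" by (simp only: of_nat_le_iff)
    thus "real (card {l\<in>S \<times> C. incidences Q Q l \<ge> 1}) \<le> 1 * (real \<tau>^2 * real \<tau>^2)" by simp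
    show "768 * harm R * (real (card Q) * real (card Q))^2 \<le> 768 * harm R * (real \<tau> * real \<tau>)^2"
      using Q by (intro mult_left_mono power_mono mult_mono) (auto simp: harm_nonneg)
  qed
  also have "\<dots> \<le> harm R * (real \<tau>^2 * real \<tau>^2) + 768 * harm R * (real \<tau> * real \<tau>)^2"
    by (intro add_mono mult_right_mono h) (auto simp: harm_nonneg)
  also have "\<dots> = 769 * harm R * real \<tau>^4" by (simp add: eval_nat_numeral algebra_simps)
  finally have s3: "(\<Sum>l\<in>S \<times> C. real (incidences Q Q l) ^ 3) \<le> 769 * harm R * real \<tau>^4" .
  have "(\<Sum>l\<in>S \<times> C. real (incidences Q Q l) ^ 2)^2 \<le>
      (\<Sum>l\<in>S \<times> C. real (incidences Q Q l)) * (\<Sum>l\<in>S \<times> C. real (incidences Q Q l) ^ 3)"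
    by (rule sum_squares_le_sum_cubes) simp
  also have "\<dots> \<le> (real (card S) * real \<tau>^2) * (769 * harm R * real \<tau>^4)"
  proof (rule mult_mono[OF _ s3])
    have "real (\<Sum>l\<in>S \<times> C. incidences Q Q l) \<le> real (card S * \<tau>^2)" using s1 by (simp only: of_nat_le_iff)
    thus "(\<Sum>l\<in>S \<times> C. real (incidences Q Q l)) \<le> real (card S) * real \<tau>^2" by simp
  qed (auto intro!: sum_nonneg simp: harm_nonneg)
  also have "\<dots> = 769 * harm R * real (card S) * real \<tau> ^ 6" by (simp add: eval_nat_numeral mult_ac)
  finally show ?thesis .
qed

text \<open>
  Few sums, many products in the manner of Elekes and Ruzsa, for a set of popular differences:
  \<open>b = q - r\<close> and \<open>t * b = q' - r'\<close> put \<open>(q, q')\<close> and \<open>(r, r')\<close> on one line of slope \<open>t\<close>.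
\<close>

lemma popular_differences_level:
  assumes fin: "finite B" "finite Q" "finite P" and card: "card B \<le> \<tau>" "card Q \<le> \<tau>" "card P \<le> \<tau>"
    and B: "0 \<notin> B" and reps: "\<And>b. b \<in> B \<Longrightarrow> t0 \<le> card {(q, p). q \<in> Q \<and> p \<in> P \<and> q - p = b}"
    and S: "finite S" "0 \<notin> S" "\<And>t. t \<in> S \<Longrightarrow> \<rho> \<le> dilate_reps B t" and "\<rho> \<ge> 1" and "\<tau> \<le> R" "R \<ge> 1"
  shows "real (card S) * real \<rho>^2 * real t0^4 \<le> 769 * harm R * real \<tau>^6"
proof (cases "S = {}")
  case True
  then show ?thesis using harm_ge_1[OF \<open>R \<ge> 1\<close>] by simp
next
  case False
  \<comment> \<open>As \<rho> >= 1, every slope is a quotient of elements of \<open>B\<close>; so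
    |S| <= \<tau>^2, as the moment bound requires.\<close>
  have "S \<subseteq> (\<lambda>(x, y). y / x) ` (B \<times> B)"
  proof
    fix t assume "t \<in> S"
    hence "dilate_reps B t > 0" using S(3) \<open>\<rho> \<ge> 1\<close> by fastforce
    hence "{b\<in>B. t * b \<in> B} \<noteq> {}" unfolding dilate_reps_def by (metis card.empty less_irrefl)
    then obtain b where b: "b \<in> B" "t * b \<in> B" by auto
    moreover have "t = t * b / b" using b B by auto
    ultimately show "t \<in> (\<lambda>(x, y). y / x) ` (B \<times> B)" by (intro image_eqI[of _ _ "(b, t * b)"]) auto
  qed
  hence "card S \<le> card ((\<lambda>(x, y). y / x) ` (B \<times> B))" using fin by (intro card_mono) auto
  also have "\<dots> \<le> card (B \<times> B)" using fin by (intro card_image_le) auto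
  also have "\<dots> \<le> \<tau>^2" using card(1) by (simp add: card_cartesian_product power2_eq_square mult_le_mono)
  finally have cS: "card S \<le> \<tau>^2" .
  define C where "C = (\<lambda>(t, x, y). y - t * x) ` (S \<times> (Q \<union> P) \<times> (Q \<union> P))"
  have fC: "finite C" unfolding C_def using fin S by auto
  have CI: "y - t * x \<in> C" if "t \<in> S" "x \<in> Q \<union> P" "y \<in> Q \<union> P" for t x y
    unfolding C_def using that by (intro image_eqI[of _ _ "(t, x, y)"]) auto
  define rep where "rep b = {(q, p). q \<in> Q \<and> p \<in> P \<and> q - p = b}" for b
  have frep: "finite (rep b)" for b
    by (rule finite_subset[of _ "Q \<times> P"]) (use fin in \<open>auto simp: rep_def\<close>)
  define M where "M = 769 * harm R * real (card S) * real \<tau> ^ 6"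
  have slope: "\<rho> * t0^2 \<le> (\<Sum>c\<in>C. incidences Q Q (t, c) * incidences P P (t, c))" if t: "t \<in> S" for t
  proof -
    define V where "V = (SIGMA b : {b\<in>B. t * b \<in> B}. rep b \<times> rep (t * b))"
    define W where "W = (SIGMA c : C. {x\<in>Q. t * x + c \<in> Q} \<times> {x\<in>P. t * x + c \<in> P})"
    \<comment> \<open>With c = q' - t q one also has p' = t p + c. Hence c, q, p recover q', p' and
      b = q - p, and \<open>f\<close> is injective.\<close>
    define f where "f = (\<lambda>(b :: real, (q, p), (q', p' :: real)). (q' - t * q, (q, p :: real)))"
    have "\<rho> * t0^2 \<le> card {b\<in>B. t * b \<in> B} * t0^2"
      using S(3)[OF t] unfolding dilate_reps_def by (rule mult_right_mono) simp
    also have "\<dots> = (\<Sum>b\<in>{b\<in>B. t * b \<in> B}. t0 * t0)" by (simp add: power2_eq_square)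
    also have "\<dots> \<le> (\<Sum>b\<in>{b\<in>B. t * b \<in> B}. card (rep b) * card (rep (t * b)))"
      by (intro sum_mono mult_le_mono) (use reps in \<open>auto simp: rep_def\<close>)
    also have "\<dots> = card V"
      unfolding V_def using fin frep by (subst card_SigmaI) (auto simp: card_cartesian_product)
    also have "\<dots> \<le> card W"
    proof (rule card_inj_on_le)
      show "inj_on f V"
        by (rule inj_onI) (auto simp: f_def V_def rep_def)
      show "f ` V \<subseteq> W"
      proof
        fix z assume "z \<in> f ` V"
        then obtain b q p q' p' where z: "z = (q' - t * q, (q, p))" "q \<in> Q" "p \<in> P" "q' \<in> Q" "p' \<in> P"
          "q - p = b" "q' - p' = t * b" unfolding f_def V_def rep_def by auto
        have "t * p + (q' - t * q) = q' - t * (q - p)" by (simp add: algebra_simps)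
        also have "\<dots> = p'" using z(6,7) by simp
        finally have "t * p + (q' - t * q) \<in> P" using z by simp
        moreover have "q' - t * q \<in> C" using CI t z(2,4) by auto
        ultimately show "z \<in> W" unfolding W_def z(1) using z by simp
      qed
      show "finite W" unfolding W_def using fC fin by auto
    qed
    also have "card W = (\<Sum>c\<in>C. incidences Q Q (t, c) * incidences P P (t, c))"
      unfolding W_def incidences_def using fC fin by (subst card_SigmaI) (auto simp: card_cartesian_product)
    finally show ?thesis .
  qed
  have "card S * (\<rho> * t0^2) = (\<Sum>t\<in>S. \<rho> * t0^2)" by simp
  also have "\<dots> \<le> (\<Sum>t\<in>S. \<Sum>c\<in>C. incidences Q Q (t, c) * incidences P P (t, c))"
    by (rule sum_mono) (rule slope)
  also have "\<dots> = (\<Sum>l\<in>S \<times> C. incidences Q Q l * incidences P P l)" by (simp add: sum.cartesian_product)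
  finally have "real (card S * (\<rho> * t0^2)) \<le> real (\<Sum>l\<in>S \<times> C. incidences Q Q l * incidences P P l)"
    by (simp only: of_nat_le_iff)
  hence "(real (card S) * (real \<rho> * real t0^2))^2 \<le>
      (\<Sum>l\<in>S \<times> C. real (incidences Q Q l) * real (incidences P P l))^2"
    by (intro power_mono) auto
  also have "\<dots> \<le> (\<Sum>l\<in>S \<times> C. real (incidences Q Q l)^2) * (\<Sum>l\<in>S \<times> C. real (incidences P P l)^2)"
    by (rule Cauchy_Schwarz_ineq_sum)
  \<comment> \<open>Each factor has square at most \<open>M\<close>, so the product is at most
    \<open>M\<close>. Only one of the two factors |S| on the left is then spent against
    \<open>M\<close>.\<close>
  also have "\<dots> \<le> M"
  proof (rule power2_le_imp_le)
    have "((\<Sum>l\<in>S \<times> C. real (incidences Q Q l)^2) * (\<Sum>l\<in>S \<times> C. real (incidences P P l)^2))^2 =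
      (\<Sum>l\<in>S \<times> C. real (incidences Q Q l)^2)^2 * (\<Sum>l\<in>S \<times> C. real (incidences P P l)^2)^2"
      by (rule power_mult_distrib)
    also have "\<dots> \<le> M * M" unfolding M_def
      by (rule mult_mono; (rule sum_incidences_squared_le)?)
        (use fin card S cS fC \<open>\<tau> \<le> R\<close> \<open>R \<ge> 1\<close> harm_ge_1[OF \<open>R \<ge> 1\<close>] in \<open>auto intro: CI\<close>)
    finally show "((\<Sum>l\<in>S \<times> C. real (incidences Q Q l)^2) * (\<Sum>l\<in>S \<times> C. real (incidences P P l)^2))^2 \<le> M^2"
      by (simp add: power2_eq_square)
    show "0 \<le> M" unfolding M_def using harm_ge_1[OF \<open>R \<ge> 1\<close>] by simp
  qed
  finally have "real (card S) * (real (card S) * real \<rho>^2 * real t0^4) \<le> real (card S) * (769 * harm R * real \<tau>^6)"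
    unfolding M_def by (simp add: power_mult_distrib power2_eq_square eval_nat_numeral mult_ac)
  moreover have "real (card S) > 0" using False S by (simp add: card_gt_0_iff)
  ultimately show ?thesis by simp
qed

text \<open>If \<open>t0\<close> is of order \<tau>, the energy of \<open>B\<close> is at most
  \<tau>^2 up to logarithms, the least possible order for a set of about \<tau> elements.\<close>

lemma popular_differences_energy:
  assumes fin: "finite B" "finite Q" "finite P" and card: "card B \<le> \<tau>" "card Q \<le> \<tau>" "card P \<le> \<tau>"
    and B: "0 \<notin> B" and reps: "\<And>b. b \<in> B \<Longrightarrow> t0 \<le> card {(q, p). q \<in> Q \<and> p \<in> P \<and> q - p = b}"
    and T: "finite T" "0 \<notin> T" and "\<tau> \<le> R" "R \<ge> 1" and "t0 > 0"
  shows "(\<Sum>t\<in>T. real (dilate_reps B t) ^ 2) * real t0^4 \<le> 1538 * (harm R)^2 * real \<tau>^6"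
proof -
  have "(\<Sum>t\<in>T. real (dilate_reps B t) ^ 2) \<le> 2 * (769 * harm R * real \<tau>^6 / real t0^4) * harm R"
  proof (rule sum_squares_le_harm[OF T(1)])
    fix t
    show "dilate_reps B t \<le> R"
      using card_mono[OF fin(1), of "{a\<in>B. t * a \<in> B}"] card \<open>\<tau> \<le> R\<close> unfolding dilate_reps_def by simp
  next
    fix k :: nat assume "1 \<le> k"
    have "real (card {t\<in>T. k \<le> dilate_reps B t}) * real k^2 * real t0^4 \<le> 769 * harm R * real \<tau>^6"
      by (rule popular_differences_level[OF fin card B reps]) (use T assms \<open>1 \<le> k\<close> in auto)
    thus "real (card {t\<in>T. k \<le> dilate_reps B t}) * real k^2 \<le> 769 * harm R * real \<tau>^6 / real t0^4"
      using \<open>t0 > 0\<close> by (simp add: pos_le_divide_eq)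
  qed
  thus ?thesis using \<open>t0 > 0\<close> by (simp add: field_simps power2_eq_square)
qed

text \<open>The solutions of a b = a' b' are grouped by t = b' / b = a / a'. Cauchy-Schwarz bounds
  their number below by means of |A * B|, and above by the geometric mean of the two
  energies.\<close>

lemma card_product_set_ge:
  assumes fin: "finite A" "finite B" and nz: "0 \<notin> A" "0 \<notin> (B :: real set)"
  defines "T \<equiv> (\<lambda>(x, y). y / x) ` (B \<times> B)"
  assumes EA: "(\<Sum>t\<in>T. real (dilate_reps A t) ^ 2) \<le> EA" and EB: "(\<Sum>t\<in>T. real (dilate_reps B t) ^ 2) \<le> EB"
  shows "real (card A)^4 * real (card B)^4 \<le> real (card (A * B))^2 * (EA * EB)"
proof -
  define V where "V = {(u, v). u \<in> A \<times> B \<and> v \<in> A \<times> B \<and> (\<lambda>(a, b). a * b) u = (\<lambda>(a, b). a * b) v}"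
  define W where "W = (SIGMA t : T. {a\<in>A. t * a \<in> A} \<times> {b\<in>B. t * b \<in> B})"
  define f where "f = (\<lambda>((a :: real, b :: real), (a' :: real, b' :: real)). (b' / b, (a', b)))"
  have fT: "finite T" unfolding T_def using fin by auto
  have img: "(\<lambda>(a, b). a * b) ` (A \<times> B) = A * B" by (auto simp: set_times_def)
  have nz': "a \<noteq> 0" "b \<noteq> 0" if "a \<in> A" "b \<in> B" for a b using that nz by auto
  have "card V \<le> card W"
  proof (rule card_inj_on_le)
    show "inj_on f V"
    proof (rule inj_onI)
      fix u v assume "u \<in> V" "v \<in> V" and eq: "f u = f v"
      obtain a b a' b' where u: "u = ((a, b), (a', b'))" by (metis surj_pair)
      obtain c d c' d' where v: "v = ((c, d), (c', d'))" by (metis surj_pair)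
      have U: "a \<in> A" "b \<in> B" "a' \<in> A" "b' \<in> B" "a * b = a' * b'" using \<open>u \<in> V\<close> unfolding u V_def by auto
      have V: "c \<in> A" "d \<in> B" "c' \<in> A" "d' \<in> B" "c * d = c' * d'" using \<open>v \<in> V\<close> unfolding v V_def by auto
      have e: "b' / b = d' / d" "c' = a'" "d = b" using eq unfolding u v f_def by auto
      hence "b' = d'" using nz' U V by auto
      moreover have "a = c" using U(5) V(5) e \<open>b' = d'\<close> nz' U by (metis mult_right_cancel)
      ultimately show "u = v" unfolding u v using e by simp
    qed
    show "f ` V \<subseteq> W"
    proof
      fix z assume "z \<in> f ` V"
      then obtain a b a' b' where z: "z = (b' / b, (a', b))" "a \<in> A" "b \<in> B" "a' \<in> A" "b' \<in> B" "a * b = a' * b'"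
        unfolding f_def V_def by auto
      have "b' / b * b = b'" "b' / b * a' = a" using z nz' by (auto simp: field_simps)
      moreover have "b' / b \<in> T" unfolding T_def using z by (intro image_eqI[of _ _ "(b, b')"]) auto
      ultimately show "z \<in> W" unfolding W_def using z by auto
    qed
    show "finite W" unfolding W_def using fT fin by auto
  qed
  also have "card W = (\<Sum>t\<in>T. dilate_reps A t * dilate_reps B t)"
    unfolding W_def dilate_reps_def using fT fin by (subst card_SigmaI) (auto simp: card_cartesian_product)
  finally have "real (card V) \<le> real (\<Sum>t\<in>T. dilate_reps A t * dilate_reps B t)" by (simp only: of_nat_le_iff)
  hence "real (card V)^2 \<le> (\<Sum>t\<in>T. real (dilate_reps A t) * real (dilate_reps B t))^2"
    by (intro power_mono) auto
  also have "\<dots> \<le> (\<Sum>t\<in>T. real (dilate_reps A t)^2) * (\<Sum>t\<in>T. real (dilate_reps B t)^2)"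
    by (rule Cauchy_Schwarz_ineq_sum)
  also have "\<dots> \<le> EA * EB"
    using order.trans[OF sum_nonneg EA] by (intro mult_mono EA EB) (auto intro!: sum_nonneg)
  finally have V: "real (card V)^2 \<le> EA * EB" .
  have "real (card A)^4 * real (card B)^4 = (real (card (A \<times> B))^2)^2"
    by (simp add: card_cartesian_product eval_nat_numeral mult_ac)
  also have "\<dots> \<le> (real (card (A * B)) * real (card V))^2"
    using card_collisions[of "A \<times> B" "\<lambda>(a, b). a * b"] fin unfolding img V_def[symmetric]
    by (intro power_mono) auto
  also have "\<dots> = real (card (A * B))^2 * real (card V)^2" by (rule power_mult_distrib)
  also have "\<dots> \<le> real (card (A * B))^2 * (EA * EB)" by (intro mult_left_mono V) simp
  finally show ?thesis .
qed

text \<open>Solving a x + b y = c z for x exhibits elements of \<open>F1\<close> as popular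
  differences of dilates of \<open>F3\<close> and \<open>F2\<close>. Those of popularity at least k
  form a set \<open>B\<close> of small energy, so \<open>A * B\<close> is large. Both k and |B|
  enter with the fourth power, so a lower bound for k |B| is enough.\<close>

lemma product_set_ge_of_coincidences:
  fixes A F1 F2 F3 :: "real set" and a b c :: real
  assumes A: "finite A" "A \<subseteq> {0<..}" and N: "card (A + A) \<le> N" and F: "F1 \<subseteq> A" "F2 \<subseteq> A" "F3 \<subseteq> A"
    and card: "card F1 = \<tau>" "card F2 = \<tau>" "card F3 = \<tau>" and nz: "a \<noteq> 0" "b \<noteq> 0" "c \<noteq> 0"
    and many: "\<tau>^2 < 2 * m^2 * card {(x, y). x \<in> F1 \<and> y \<in> F2 \<and> (\<exists>z\<in>F3. a * x + b * y = c * z)}"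
    and R: "card A \<le> R" and "\<tau> > 0"
  shows "real (card A)^4 * real \<tau>^2 \<le> 300000 * real m^8 * harm R^7 * real N^2 * real (card (A * F1))^2"
proof -
  define h where "h = (harm R :: real)"
  have finF: "finite F1" "finite F2" "finite F3" using F A by (auto intro: finite_subset)
  have tauR: "\<tau> \<le> R" using card(1) F(1) A R by (metis card_mono order.trans)
  have h: "h \<ge> 1" unfolding h_def using tauR \<open>\<tau> > 0\<close> by (intro harm_ge_1) simp
  define G where "G = {(x, y). x \<in> F1 \<and> y \<in> F2 \<and> (\<exists>z\<in>F3. a * x + b * y = c * z)}"
  define r where "r x = card {y\<in>F2. \<exists>z\<in>F3. a * x + b * y = c * z}" for x
  have r_le: "r x \<le> \<tau>" for x unfolding r_def card(2)[symmetric] using finF by (auto intro: card_mono)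
  have "G = (SIGMA x : F1. {y\<in>F2. \<exists>z\<in>F3. a * x + b * y = c * z})" unfolding G_def by auto
  hence cG: "card G = (\<Sum>x\<in>F1. r x)" using finF unfolding r_def by simp
  have "real (card G) = (\<Sum>x\<in>F1. \<Sum>k=1..r x. 1)" unfolding cG by simp
  also have "\<dots> = (\<Sum>k=1..\<tau>. 1 * real (card {x\<in>F1. k \<le> r x}))" by (rule sum_layers) (use finF r_le in auto)
  finally have layers: "real (card G) = (\<Sum>k=1..\<tau>. real (card {x\<in>F1. k \<le> r x}))" by simp
  have "card G > 0" using many unfolding G_def[symmetric] by (cases "card G = 0") auto
  \<comment> \<open>The level is chosen to make k |B| at least |G| / h; neither factor is controlled
    separately.\<close>
  then obtain k where k: "k \<in> {1..\<tau>}" "real (card G) \<le> h * (k * real (card {x\<in>F1. k \<le> r x}))"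
    using harmonic_pigeonhole[of "{1..\<tau>}" R "real (card G)" "\<lambda>k. real (card {x\<in>F1. k \<le> r x})"] tauR layers
    unfolding h_def by auto
  define B where "B = {x\<in>F1. k \<le> r x}"
  have BF: "B \<subseteq> F1" unfolding B_def by auto
  have finB: "finite B" using finF BF finite_subset by blast
  have cB: "card B \<le> \<tau>" using card_mono[OF finF(1) BF] card by simp
  define Q where "Q = (\<lambda>z. c / a * z) ` F3"
  define P where "P = (\<lambda>y. b / a * y) ` F2"
  have reps: "k \<le> card {(q, p). q \<in> Q \<and> p \<in> P \<and> q - p = x}" if "x \<in> B" for x
  proof -
    let ?Y = "{y\<in>F2. \<exists>z\<in>F3. a * x + b * y = c * z}"
    let ?f = "\<lambda>y. (x + b / a * y, b / a * y)"
    have "k \<le> card ?Y" using that unfolding B_def r_def by auto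
    also have "\<dots> = card (?f ` ?Y)" using nz by (intro card_image[symmetric] inj_onI) auto
    also have "\<dots> \<le> card {(q, p). q \<in> Q \<and> p \<in> P \<and> q - p = x}"
    proof (rule card_mono)
      show "finite {(q, p). q \<in> Q \<and> p \<in> P \<and> q - p = x}"
        by (rule finite_subset[of _ "Q \<times> P"]) (use finF in \<open>auto simp: Q_def P_def\<close>)
      have "x + b / a * y \<in> Q" if "z \<in> F3" "a * x + b * y = c * z" for y z
      proof -
        have "x + b / a * y = (a * x + b * y) / a" using nz by (simp add: field_simps)
        also have "\<dots> = c / a * z" using that by simp
        finally show ?thesis unfolding Q_def using that by blast
      qed
      thus "?f ` ?Y \<subseteq> {(q, p). q \<in> Q \<and> p \<in> P \<and> q - p = x}" unfolding P_def by auto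
    qed
    finally show ?thesis .
  qed
  define T where "T = (\<lambda>(x, y). y / x) ` (B \<times> B)"
  have pos: "x > 0" if "x \<in> A" for x using that A by auto
  have nzAB: "0 \<notin> A" "0 \<notin> B" using pos BF F by auto
  have T: "finite T" "0 \<notin> T" unfolding T_def using finB nzAB by auto
  define EB where "EB = 1538 * h^2 * real \<tau>^6 / real k^4"
  have EB: "(\<Sum>t\<in>T. real (dilate_reps B t)^2) \<le> EB"
  proof -
    have "(\<Sum>t\<in>T. real (dilate_reps B t)^2) * real k^4 \<le> 1538 * h^2 * real \<tau>^6"
      unfolding h_def
    proof (rule popular_differences_energy[where Q = Q and P = P])
      show "card Q \<le> \<tau>" "card P \<le> \<tau>" unfolding Q_def P_def using card finF card_image_le by metis+
    qed (use finB cB nzAB reps T tauR k finF in \<open>auto simp: Q_def P_def\<close>)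
    thus ?thesis unfolding EB_def using k by (simp add: pos_le_divide_eq)
  qed
  have EA: "(\<Sum>t\<in>T. real (dilate_reps A t)^2) \<le> 12 * real N^2 * h"
  proof -
    have "(\<Sum>t\<in>T. real (dilate_reps A t)^2) \<le> 12 * real (card (A + A))^2 * h"
      unfolding h_def by (rule dilate_energy_le[OF A T(1) R])
    also have "\<dots> \<le> 12 * real N^2 * h" using N h by (intro mult_right_mono mult_left_mono power_mono) auto
    finally show ?thesis .
  qed
  define X where "X = real (card (A * F1))"
  have "real (card A)^4 * real (card B)^4 \<le> real (card (A * B))^2 * (12 * real N^2 * h * EB)"
    using A finB nzAB EA EB unfolding T_def by (intro card_product_set_ge) auto
  also have "\<dots> \<le> X^2 * (12 * real N^2 * h * EB)"
  proof (intro mult_right_mono power_mono)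
    have "A * B \<subseteq> A * F1" using BF by (intro set_times_mono2) auto
    thus "real (card (A * B)) \<le> X" unfolding X_def using A finF by (simp add: card_mono finite_set_times)
    show "0 \<le> 12 * real N^2 * h * EB" unfolding EB_def using h by simp
  qed simp
  finally have "(real (card A)^4 * real (card B)^4) * real k^4 \<le> X^2 * (12 * real N^2 * h * EB) * real k^4"
    by (rule mult_right_mono) simp
  also have "\<dots> = X^2 * (12 * real N^2 * h) * (EB * real k^4)" by simp
  also have "EB * real k^4 = 1538 * h^2 * real \<tau>^6" unfolding EB_def using k by simp
  finally have 1: "real (card A)^4 * (real k * real (card B))^4 \<le> 18456 * X^2 * real N^2 * h^3 * real \<tau>^6"
    by (simp add: power_mult_distrib eval_nat_numeral mult_ac)
  have "real (\<tau>^2) \<le> real (2 * m^2 * card G)" using many unfolding G_def[symmetric] of_nat_le_iff by simp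
  hence "real \<tau>^2 \<le> 2 * real m^2 * real (card G)" by simp
  also have "\<dots> \<le> 2 * real m^2 * (h * (real k * real (card B)))"
    using k(2) unfolding B_def by (intro mult_left_mono) auto
  finally have "(real \<tau>^2)^4 \<le> (2 * real m^2 * (h * (real k * real (card B))))^4" by (rule power_mono) simp
  hence 2: "real \<tau>^8 \<le> 16 * real m^8 * h^4 * (real k * real (card B))^4"
    by (simp add: power_mult_distrib power_mult[symmetric])
  have "real \<tau>^6 * (real (card A)^4 * real \<tau>^2) = real (card A)^4 * real \<tau>^8"
    by (simp add: eval_nat_numeral mult_ac)
  also have "\<dots> \<le> real (card A)^4 * (16 * real m^8 * h^4 * (real k * real (card B))^4)"
    by (intro mult_left_mono 2) simp
  also have "\<dots> = 16 * real m^8 * h^4 * (real (card A)^4 * (real k * real (card B))^4)" by (simp only: mult_ac)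
  also have "\<dots> \<le> 16 * real m^8 * h^4 * (18456 * X^2 * real N^2 * h^3 * real \<tau>^6)"
    using h by (intro mult_left_mono 1) simp
  also have "\<dots> = real \<tau>^6 * (295296 * (real m^8 * h^7 * real N^2 * X^2))"
    by (simp add: eval_nat_numeral mult_ac)
  finally have "real (card A)^4 * real \<tau>^2 \<le> 295296 * (real m^8 * h^7 * real N^2 * X^2)"
    using \<open>\<tau> > 0\<close> by simp
  also have "\<dots> \<le> 300000 * (real m^8 * h^7 * real N^2 * X^2)" using h by (intro mult_right_mono) auto
  finally show ?thesis unfolding X_def h_def by (simp add: mult_ac)
qed

section \<open>Popular quotients\<close>

lemma sum_dilate_reps:
  assumes "finite A" "0 \<notin> A" "(\<lambda>(x, y). y / x) ` (A \<times> A) \<subseteq> T" "finite T"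
  shows "(\<Sum>t\<in>T. dilate_reps A t) = card A ^ 2"
proof -
  have "card (A \<times> A) = (\<Sum>t\<in>T. card {p\<in>A \<times> A. (\<lambda>(x, y). y / x) p = t})"
    by (rule card_eq_sum_fibres) (use assms in auto)
  also have "\<dots> = (\<Sum>t\<in>T. dilate_reps A t)"
  proof (rule sum.cong[OF refl])
    fix t
    have nz: "x \<noteq> 0" if "x \<in> A" for x using that assms(2) by auto
    have "{p\<in>A \<times> A. (\<lambda>(x, y). y / x) p = t} = (\<lambda>x. (x, t * x)) ` {x\<in>A. t * x \<in> A}"
    proof (intro equalityI subsetI)
      fix p assume "p \<in> {p\<in>A \<times> A. (\<lambda>(x, y). y / x) p = t}"
      then obtain x y where p: "p = (x, y)" "x \<in> A" "y \<in> A" "y / x = t" by auto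
      hence "y = t * x" using nz by auto
      thus "p \<in> (\<lambda>x. (x, t * x)) ` {x\<in>A. t * x \<in> A}" using p by auto
    qed (use nz in auto)
    thus "card {p\<in>A \<times> A. (\<lambda>(x, y). y / x) p = t} = dilate_reps A t"
      unfolding dilate_reps_def by (simp add: card_image inj_on_def)
  qed
  finally show ?thesis by (simp add: card_cartesian_product power2_eq_square)
qed

text \<open>Each level has at most N slopes, so levels below n^2 / (2N) account for at most half of
  the n^2 pairs; pigeonholing the other levels makes \<tau> large.\<close>

lemma rich_slopes:
  fixes N :: nat
  assumes A: "finite A" "0 \<notin> A" "A \<noteq> {}" and N: "card (A * inverse ` A) \<le> N" and R: "card A \<le> R"
  obtains \<tau> S where "\<tau> \<ge> 1" "finite S" "\<And>t. t \<in> S \<Longrightarrow> \<tau> \<le> dilate_reps A t"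
    "real (card A)^2 \<le> 2 * real N * real \<tau>" "real (card A)^2 \<le> 2 * harm R * real \<tau> * real (card S)"
proof -
  define n where "n = card A"
  define T where "T = A * inverse ` A"
  have fT: "finite T" unfolding T_def using A by (simp add: finite_set_times)
  have "(\<lambda>(x, y). y / x) ` (A \<times> A) \<subseteq> T" unfolding T_def by (auto simp: divide_inverse intro!: set_times_intro)
  hence sum: "(\<Sum>t\<in>T. dilate_reps A t) = n^2" unfolding n_def by (rule sum_dilate_reps[OF A(1,2) _ fT])
  define f where "f k = card {t\<in>T. k \<le> dilate_reps A t}" for k
  have fN: "f k \<le> N" for k
    using card_mono[OF fT, of "{t\<in>T. k \<le> dilate_reps A t}"] N unfolding f_def T_def by auto
  have "real (n^2) = (\<Sum>t\<in>T. \<Sum>k=1..dilate_reps A t. 1)" unfolding sum[symmetric] by simp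
  also have "\<dots> = (\<Sum>k=1..n. 1 * real (f k))" unfolding f_def
  proof (rule sum_layers[OF fT])
    fix t show "dilate_reps A t \<le> n"
      using card_mono[OF A(1), of "{a\<in>A. t * a \<in> A}"] unfolding dilate_reps_def n_def by simp
  qed
  also have "\<dots> = real (\<Sum>k=1..n. f k)" by simp
  finally have layers: "n^2 = (\<Sum>k=1..n. f k)" by (simp only: of_nat_eq_iff)
  define K where "K = {k\<in>{1..n}. n^2 \<le> 2 * N * k}"
  define K' where "K' = {k\<in>{1..n}. \<not> n^2 \<le> 2 * N * k}"
  have "K' \<subseteq> {1..n^2 div (2 * N)}"
  proof
    fix k assume "k \<in> K'"
    hence k: "k \<ge> 1" "2 * N * k < n^2" unfolding K'_def by auto
    have "N > 0"
    proof (rule ccontr)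
      assume "\<not> N > 0"
      hence "T = {}" using N fT unfolding T_def by simp
      thus False using A unfolding T_def by (auto simp: set_times_def)
    qed
    thus "k \<in> {1..n^2 div (2 * N)}" using k by (auto simp: less_eq_div_iff_mult_less_eq mult_ac)
  qed
  hence "card K' \<le> n^2 div (2 * N)" using card_mono[of "{1..n^2 div (2 * N)}" K'] by simp
  hence "2 * (\<Sum>k\<in>K'. f k) \<le> (2 * N) * (n^2 div (2 * N))"
    using sum_bounded_above[of K' f N] fN by (simp add: mult.commute) (meson le_trans mult_le_mono2)
  also have "\<dots> \<le> n^2" by (rule times_div_less_eq_dividend)
  finally have "2 * (\<Sum>k\<in>K'. f k) \<le> n^2" .
  moreover have "n^2 = (\<Sum>k\<in>K. f k) + (\<Sum>k\<in>K'. f k)"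
  proof -
    have "{1..n} = K \<union> K'" "K \<inter> K' = {}" "finite K" "finite K'" unfolding K_def K'_def by auto
    thus ?thesis using layers by (simp add: sum.union_disjoint)
  qed
  ultimately have "n^2 \<le> 2 * (\<Sum>k\<in>K. f k)" by linarith
  hence "real (n^2) \<le> real (2 * (\<Sum>k\<in>K. f k))" by (simp only: of_nat_le_iff)
  hence "real (n^2) / 2 \<le> (\<Sum>k\<in>K. real (f k))" by simp
  moreover have "K \<subseteq> {1..R}" unfolding K_def using R n_def by auto
  moreover have "n > 0" unfolding n_def using A by (simp add: card_gt_0_iff)
  ultimately obtain \<tau> where tau: "\<tau> \<in> K" "real (n^2) / 2 \<le> harm R * (\<tau> * real (f \<tau>))"
    using harmonic_pigeonhole[of K R "real (n^2) / 2" "\<lambda>k. real (f k)"] by auto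
  show thesis
  proof (rule that[of \<tau> "{t\<in>T. \<tau> \<le> dilate_reps A t}"])
    have "n^2 \<le> 2 * N * \<tau>" using tau unfolding K_def by simp
    hence "real (n^2) \<le> real (2 * N * \<tau>)" by (simp only: of_nat_le_iff)
    thus "real (card A)^2 \<le> 2 * real N * real \<tau>" unfolding n_def by simp
    show "real (card A)^2 \<le> 2 * harm R * real \<tau> * real (card {t\<in>T. \<tau> \<le> dilate_reps A t})"
      using tau(2) unfolding f_def n_def by simp
  qed (use tau fT in \<open>auto simp: K_def\<close>)
qed

text \<open>Both \<open>A * F\<close> and its dilate by \<open>t\<close> lie in \<open>A * A\<close>.\<close>

lemma katz_koester:
  assumes "finite (A :: real set)" "F \<subseteq> {a\<in>A. t * a \<in> A}"
  shows "card (A * F) \<le> card {q \<in> A * A. t * q \<in> A * A}"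
proof (rule card_mono)
  show "finite {q \<in> A * A. t * q \<in> A * A}" using assms by (simp add: finite_set_times)
  show "A * F \<subseteq> {q \<in> A * A. t * q \<in> A * A}"
  proof
    fix q assume "q \<in> A * F"
    then obtain a b where q: "q = a * b" "a \<in> A" "b \<in> F" by (auto simp: set_times_def)
    hence "b \<in> A" "t * b \<in> A" using assms by auto
    hence "a * b \<in> A * A" "a * (t * b) \<in> A * A" using q by (blast intro: set_times_intro)+
    moreover have "t * q = a * (t * b)" using q by simp
    ultimately show "q \<in> {q \<in> A * A. t * q \<in> A * A}" unfolding mem_Collect_eq using q(1) by metis
  qed
qed

text \<open>A coincidence among poor slopes would make some \<open>A * F l\<close> large, hence by
  \<open>katz_koester\<close> the slope \<open>l\<close> not poor. So poor slopes have none, and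
  \<open>slopes_bound\<close> applies to them with an m too large to be possible if they are more
  than half of \<open>S\<close>.\<close>

lemma few_poor_slopes:
  fixes A :: "real set" and N \<tau> :: nat and \<theta> h n :: real
  assumes A: "finite A" "A \<subseteq> {0<..}" "A \<noteq> {}" and N: "card (A + A) \<le> N" and R: "card A \<le> R"
  defines "h \<equiv> harm R" and "n \<equiv> real (card A)"
  assumes S: "finite S" "\<And>t. t \<in> S \<Longrightarrow> \<tau> \<le> dilate_reps A t" and "\<tau> \<ge> 1"
    and tau: "n^2 \<le> 2 * real N * real \<tau>" and cS: "n^2 \<le> 2 * h * real \<tau> * real (card S)"
    and small: "512 * h^2 * real N^2 \<le> n^4"
    and theta: "\<theta> > 0" "10^24 * h^16 * real N^28 * \<theta>^2 \<le> n^40"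
  shows "2 * card {t\<in>S. card {q \<in> A * A. t * q \<in> A * A} < \<theta>} \<le> card S"
proof (rule ccontr)
  define S' where "S' = {t\<in>S. card {q \<in> A * A. t * q \<in> A * A} < \<theta>}"
  define s where "s = real (card S')"
  assume "\<not> 2 * card {t\<in>S. card {q \<in> A * A. t * q \<in> A * A} < \<theta>} \<le> card S"
  hence s: "real (card S) \<le> 2 * s" unfolding s_def S'_def by linarith
  have n: "n \<ge> 1" unfolding n_def using A by (simp add: Suc_le_eq card_gt_0_iff)
  have N1: "real N \<ge> 1" using card_le_sumset[OF A(1,3)] N n unfolding n_def by linarith
  have h: "h \<ge> 1" unfolding h_def using n R unfolding n_def by (intro harm_ge_1) linarith
  have t: "real \<tau> \<ge> 1" using \<open>\<tau> \<ge> 1\<close> by simp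
  have SA: "real (card S) * real \<tau>^2 \<le> 6 * real N^2"
  proof -
    have "card S * \<tau>^2 \<le> 6 * card (A + A)^2" by (rule solymosi_level[OF A(1,2) S])
    also have "\<dots> \<le> 6 * N^2" using N by (simp add: power_mono)
    finally have "real (card S * \<tau>^2) \<le> real (6 * N^2)" by (simp only: of_nat_le_iff)
    thus ?thesis by simp
  qed
  \<comment> \<open>The threshold for m: from n^2 <= 4 h \<tau> s and s m \<tau>^2 <= 8 N^2 follows
    m <= \<mu>.\<close>
  define \<mu> where "\<mu> = 32 * h * real N^2 / (n^2 * real \<tau>)"
  have npos: "n^2 * real \<tau> > 0" using n t by simp
  have mu: "\<mu> * (n^2 * real \<tau>) = 32 * h * real N^2"
    unfolding \<mu>_def using npos by (metis less_irrefl nonzero_divide_eq_eq)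
  have "n^2 * real \<tau> \<le> (2 * h * real \<tau> * real (card S)) * real \<tau>" using cS t by (intro mult_right_mono) auto
  also have "\<dots> = 2 * h * (real (card S) * real \<tau>^2)" by (simp add: power2_eq_square)
  also have "\<dots> \<le> 2 * h * (6 * real N^2)" using SA h by (intro mult_left_mono) auto
  also have "\<dots> \<le> 32 * h * real N^2" using h by simp
  finally have mu1: "\<mu> \<ge> 1" unfolding \<mu>_def using npos by (simp add: le_divide_eq)
  \<comment> \<open>Strictly above \<mu> for the final contradiction, yet at most 2 \<mu> as \<mu>
    >= 1.\<close>
  define m where "m = nat \<lfloor>\<mu>\<rfloor> + 1"
  have m: "\<mu> < real m" "real m \<le> 2 * \<mu>" "m \<ge> 1" unfolding m_def using mu1 by linarith+
  have "\<exists>B\<subseteq>{a\<in>A. t * a \<in> A}. card B = \<tau>" if "t \<in> S" for t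
    using S(2)[OF that] obtain_subset_with_card_n[of \<tau> "{a\<in>A. t * a \<in> A}"] unfolding dilate_reps_def by metis
  then obtain F where F: "\<And>t. t \<in> S \<Longrightarrow> F t \<subseteq> {a\<in>A. t * a \<in> A}" "\<And>t. t \<in> S \<Longrightarrow> card (F t) = \<tau>" by metis
  have nc: "2 * m^2 * card {(x, y). x \<in> F l \<and> y \<in> F u \<and> (\<exists>z\<in>F v. a * x + b * y = c * z)} \<le> \<tau>^2"
    if lS: "l \<in> S'" "u \<in> S'" "v \<in> S'" and nz: "a \<noteq> 0" "b \<noteq> 0" "c \<noteq> 0" for l u v a b c
  proof (rule ccontr)
    assume "\<not> ?thesis"
    hence gt: "\<tau>^2 < 2 * m^2 * card {(x, y). x \<in> F l \<and> y \<in> F u \<and> (\<exists>z\<in>F v. a * x + b * y = c * z)}" by simp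
    have lS': "l \<in> S" "u \<in> S" "v \<in> S" using lS unfolding S'_def by auto
    define X where "X = real (card (A * F l))"
    have "n^4 * real \<tau>^2 \<le> 300000 * real m^8 * h^7 * real N^2 * X^2"
      unfolding n_def h_def X_def
      by (rule product_set_ge_of_coincidences[OF A(1,2) N _ _ _ F(2)[OF lS'(1)] F(2)[OF lS'(2)] F(2)[OF lS'(3)] nz gt R])
        (use F(1)[OF lS'(1)] F(1)[OF lS'(2)] F(1)[OF lS'(3)] \<open>\<tau> \<ge> 1\<close> in auto)
    \<comment> \<open>The factor clears the denominators of m^8, as m n^2 \<tau> <= 64 h N^2. The
      remaining \<tau>^10 is removed by n^2 <= 2 N \<tau>.\<close>
    hence "(n^4 * real \<tau>^2) * (n^2 * real \<tau>)^8 \<le> (300000 * real m^8 * h^7 * real N^2 * X^2) * (n^2 * real \<tau>)^8"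
      by (rule mult_right_mono) simp
    also have "\<dots> = (300000 * h^7 * real N^2 * X^2) * (real m * (n^2 * real \<tau>))^8"
      by (simp only: power_mult_distrib mult_ac)
    also have "\<dots> \<le> (300000 * h^7 * real N^2 * X^2) * (64 * h * real N^2)^8"
    proof (intro mult_left_mono power_mono)
      have "real m * (n^2 * real \<tau>) \<le> 2 * \<mu> * (n^2 * real \<tau>)" using m npos by (intro mult_right_mono) auto
      thus "real m * (n^2 * real \<tau>) \<le> 64 * h * real N^2" using mu by simp
    qed (use h n in auto)
    also have "\<dots> = (300000 * 64^8) * (h^15 * real N^18 * X^2)"
      by (simp add: power_mult_distrib power_mult[symmetric] power_add[symmetric] eval_nat_numeral mult_ac)
    finally have 1: "n^20 * real \<tau>^10 \<le> (300000 * 64^8) * (h^15 * real N^18 * X^2)"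
      by (simp add: power_mult_distrib power_mult[symmetric] eval_nat_numeral mult_ac)
    have "n^40 = n^20 * (n^2)^10" by (simp add: power_mult[symmetric] power_add[symmetric])
    also have "\<dots> \<le> n^20 * (2 * real N * real \<tau>)^10" 
      by (rule mult_left_mono[OF power_mono[OF tau]]) (use n in auto)
    also have "\<dots> = (2 * real N)^10 * (n^20 * real \<tau>^10)" by (simp only: power_mult_distrib mult_ac)
    also have "\<dots> \<le> (2 * real N)^10 * ((300000 * 64^8) * (h^15 * real N^18 * X^2))" by (intro mult_left_mono 1) simp
    also have "\<dots> = (1024 * 300000 * 64^8) * (h^15 * real N^28 * X^2)"
      by (simp add: power_mult_distrib power_add[symmetric] eval_nat_numeral mult_ac)
    \<comment> \<open>Relaxed to the square of 10^12 h^8 N^14 \<theta>, so that \<theta> can be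
      defined without roots.\<close>
    also have "\<dots> < 10^24 * (h^16 * real N^28 * \<theta>^2)"
    proof -
      have "X \<le> card {q \<in> A * A. l * q \<in> A * A}"
        unfolding X_def of_nat_le_iff by (rule katz_koester[OF A(1) F(1)[OF lS'(1)]])
      also have "\<dots> < \<theta>" using lS(1) unfolding S'_def by simp
      finally have "X^2 < \<theta>^2" unfolding X_def by (intro power_strict_mono) auto
      hence "h^15 * real N^28 * X^2 < h^15 * real N^28 * \<theta>^2" using h N1 by (intro mult_strict_left_mono) auto
      also have "\<dots> \<le> h^16 * real N^28 * \<theta>^2"
        using h by (intro mult_right_mono power_increasing) auto
      finally have lt: "h^15 * real N^28 * X^2 < h^16 * real N^28 * \<theta>^2" .
      have "(1024 * 300000 * 64^8) * (h^15 * real N^28 * X^2) \<le> 10^24 * (h^15 * real N^28 * X^2)"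
        using h by (intro mult_right_mono) auto
      also have "\<dots> < 10^24 * (h^16 * real N^28 * \<theta>^2)" using lt by (intro mult_strict_left_mono) auto
      finally show ?thesis .
    qed
    also have "\<dots> \<le> n^40" using theta(2) by (simp add: mult_ac)
    finally show False by simp
  qed
  define q where "q = card S' div (2 * m)"
  have "q * m^2 * \<tau>^2 \<le> 2 * card (A + A)^2" unfolding q_def
    by (rule slopes_bound[where F = F and S = S'])
      (use A S F nc m in \<open>auto simp: S'_def\<close>)
  also have "\<dots> \<le> 2 * N^2" using N by (simp add: power_mono)
  finally have "real (q * m^2 * \<tau>^2) \<le> real (2 * N^2)" by (simp only: of_nat_le_iff)
  hence q: "real q * real m^2 * real \<tau>^2 \<le> 2 * real N^2" by simp
  \<comment> \<open>The hypothesis \<open>small\<close> ensures a full block of 2m poor slopes, so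
    rounding down the number of blocks costs only a factor 2.\<close>
  have sm: "2 * real m \<le> s"
  proof -
    have "2 * real m * (n^2 * (2 * h * real \<tau>)) \<le> 4 * \<mu> * (n^2 * (2 * h * real \<tau>))"
      using m h n t by (intro mult_right_mono) auto
    also have "\<dots> = 8 * h * (\<mu> * (n^2 * real \<tau>))" by simp
    also have "\<dots> = (512 * h^2 * real N^2) / 2" unfolding mu by (simp add: power2_eq_square)
    also have "\<dots> \<le> n^4 / 2" using small by simp
    also have "\<dots> = n^2 * n^2 / 2" by (simp add: power_add[symmetric])
    also have "\<dots> \<le> n^2 * (2 * h * real \<tau> * real (card S)) / 2" using cS by (intro divide_right_mono mult_left_mono) auto
    also have "\<dots> \<le> n^2 * (2 * h * real \<tau> * (2 * s)) / 2"
      using s h by (intro divide_right_mono mult_left_mono) auto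
    also have "\<dots> = s * (n^2 * (2 * h * real \<tau>))" by simp
    finally show ?thesis using n h t by simp
  qed
  have "s \<le> 4 * real m * real q"
  proof -
    have "card S' < 2 * m * (q + 1)" unfolding q_def using m dividend_less_times_div[of "2 * m" "card S'"] by simp
    moreover have "1 \<le> q"
    proof -
      have "2 * m \<le> card S'" using sm unfolding s_def by linarith
      thus ?thesis unfolding q_def using m by (simp add: less_eq_div_iff_mult_less_eq)
    qed
    hence "2 * m * (q + 1) \<le> 2 * m * (2 * q)" by (intro mult_left_mono) auto
    moreover have "2 * m * (2 * q) = 4 * m * q" by simp
    ultimately have "card S' \<le> 4 * m * q" by linarith
    hence "real (card S') \<le> real (4 * m * q)" by (simp only: of_nat_le_iff)
    thus ?thesis unfolding s_def by simp
  qed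
  hence "s * (real m * real \<tau>^2) \<le> (4 * real m * real q) * (real m * real \<tau>^2)" by (rule mult_right_mono) simp
  also have "\<dots> = 4 * (real q * real m^2 * real \<tau>^2)" by (simp add: power2_eq_square)
  also have "\<dots> \<le> 8 * real N^2" using q by linarith
  finally have sN: "s * (real m * real \<tau>^2) \<le> 8 * real N^2" .
  have "real m * (n^2 * real \<tau>) \<le> real m * ((2 * h * real \<tau> * (2 * s)) * real \<tau>)"
  proof (intro mult_left_mono mult_right_mono)
    have "2 * h * real \<tau> * card S \<le> 2 * h * real \<tau> * (2 * s)" using s h by (intro mult_left_mono) auto
    thus "n^2 \<le> 2 * h * real \<tau> * (2 * s)" using cS by linarith
  qed auto
  also have "\<dots> = 4 * h * (s * (real m * real \<tau>^2))" by (simp add: power2_eq_square mult_ac)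
  also have "\<dots> \<le> 4 * h * (8 * real N^2)" using sN h by (intro mult_left_mono) auto
  also have "\<dots> = \<mu> * (n^2 * real \<tau>)" unfolding mu by simp
  finally have "real m \<le> \<mu>" using npos by (rule mult_right_le_imp_le)
  thus False using m by simp
qed

text \<open>The good slopes carry at least n^2 / (4h) pairs (x, y) with quotient y / x good;
  averaging over x fixes a common denominator, and \<open>C\<close> is its set of partners.\<close>

lemma popular_quotients:
  fixes A :: "real set" and N :: nat and \<theta> h n :: real
  assumes A: "finite A" "A \<subseteq> {0<..}" "A \<noteq> {}" and N: "card (A + A) \<le> N" "card (A * inverse ` A) \<le> N"
    and R: "card A \<le> R"
  defines "h \<equiv> harm R" and "n \<equiv> real (card A)"
  assumes small: "512 * h^2 * real N^2 \<le> n^4" and theta: "\<theta> > 0" "10^24 * h^16 * real N^28 * \<theta>^2 \<le> n^40"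
  obtains C x where "C \<subseteq> A" "x \<in> A" "n \<le> 4 * h * card C"
    "\<And>c. c \<in> C \<Longrightarrow> \<theta> \<le> card {q \<in> A * A. c / x * q \<in> A * A}"
proof -
  have A0: "0 \<notin> A" using A(2) by auto
  have n: "n \<ge> 1" unfolding n_def using A by (simp add: Suc_le_eq card_gt_0_iff)
  have h: "h \<ge> 1" unfolding h_def using n R unfolding n_def by (intro harm_ge_1) linarith
  obtain \<tau> S where S: "\<tau> \<ge> 1" "finite S" "\<And>t. t \<in> S \<Longrightarrow> \<tau> \<le> dilate_reps A t"
    "n^2 \<le> 2 * real N * real \<tau>" "n^2 \<le> 2 * h * real \<tau> * real (card S)"
    using rich_slopes[OF A(1) A0 A(3) N(2) R] unfolding h_def n_def by blast
  define G where "G = {t\<in>S. \<theta> \<le> card {q \<in> A * A. t * q \<in> A * A}}"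
  define S' where "S' = {t\<in>S. card {q \<in> A * A. t * q \<in> A * A} < \<theta>}"
  have "2 * card S' \<le> card S" unfolding S'_def
    by (rule few_poor_slopes[OF A N(1) R]) (use S small theta in \<open>auto simp: h_def n_def\<close>)
  moreover have "card S = card G + card S'"
  proof -
    have "S = G \<union> S'" "G \<inter> S' = {}" "finite G" "finite S'" unfolding G_def S'_def using S by auto
    thus ?thesis by (simp add: card_Un_disjoint)
  qed
  ultimately have G: "card S \<le> 2 * card G" by linarith
  have fG: "finite G" unfolding G_def using S by simp
  define c where "c x = card {y\<in>A. y / x \<in> G}" for x
  have "\<tau> * card G = (\<Sum>t\<in>G. \<tau>)" by simp
  also have "\<dots> \<le> (\<Sum>t\<in>G. dilate_reps A t)" by (rule sum_mono) (use S G_def in auto)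
  also have "\<dots> = card (SIGMA t : G. {a\<in>A. t * a \<in> A})"
    unfolding dilate_reps_def using fG A by (subst card_SigmaI) auto
  also have "\<dots> \<le> card (SIGMA x : A. {y\<in>A. y / x \<in> G})"
  proof (rule card_inj_on_le[where f = "\<lambda>(t, x). (x, t * x)"])
    have nz: "x \<noteq> 0" if "x \<in> A" for x using that A0 by auto
    show "inj_on (\<lambda>(t, x). (x, t * x)) (SIGMA t : G. {a\<in>A. t * a \<in> A})"
      by (rule inj_onI) (use nz in auto)
    show "(\<lambda>(t, x). (x, t * x)) ` (SIGMA t : G. {a\<in>A. t * a \<in> A}) \<subseteq> (SIGMA x : A. {y\<in>A. y / x \<in> G})"
      using nz by auto
    show "finite (SIGMA x : A. {y\<in>A. y / x \<in> G})" using A by auto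
  qed
  also have "\<dots> = (\<Sum>x\<in>A. c x)" unfolding c_def using A by (subst card_SigmaI) auto
  finally have cG: "\<tau> * card G \<le> (\<Sum>x\<in>A. c x)" .
  have "n^2 \<le> 4 * h * real (\<tau> * card G)"
  proof -
    have "2 * h * real \<tau> * real (card S) \<le> 2 * h * real \<tau> * real (2 * card G)"
      using G h by (intro mult_left_mono) (auto simp del: of_nat_mult)
    thus ?thesis using S(5) by simp
  qed
  also have "\<dots> \<le> 4 * h * real (\<Sum>x\<in>A. c x)" 
    using of_nat_mono[OF cG] h by (intro mult_left_mono) auto
  finally have tot: "n^2 \<le> 4 * h * (\<Sum>x\<in>A. real (c x))" by simp
  have "\<exists>x\<in>A. n \<le> 4 * h * c x"
  proof (rule ccontr)
    assume "\<not> ?thesis"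
    hence "(\<Sum>x\<in>A. 4 * h * c x) < (\<Sum>x\<in>A. n)" using A by (intro sum_strict_mono) auto
    also have "\<dots> = n^2" unfolding n_def by (simp add: power2_eq_square)
    finally show False using tot by (simp add: sum_distrib_left)
  qed
  then obtain x where x: "x \<in> A" "n \<le> 4 * h * c x" by auto
  show thesis
  proof (rule that[of "{y\<in>A. y / x \<in> G}" x])
    show "n \<le> 4 * h * card {y\<in>A. y / x \<in> G}" using x unfolding c_def by simp
  qed (use x in \<open>auto simp: G_def\<close>)
qed

section \<open>Differences\<close>

definition difference_reps :: "real set \<Rightarrow> real set \<Rightarrow> real \<Rightarrow> nat" where
  "difference_reps C Y z = card {y\<in>Y. z + y \<in> C}"

text \<open>
  If \<open>c = p / q\<close> in many ways, then \<open>c - y = z\<close> puts \<open>(y, p)\<close> on the line \<open>p = q * y + q * z\<close>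
  for as many slopes \<open>q\<close>.
\<close>

lemma sum_difference_reps_cubed_le:
  fixes \<theta> :: real
  assumes fin: "finite C" "finite Y" "finite P" "finite Q" and "0 \<notin> Q"
    and card: "card P \<le> N" "card Q \<le> N" and Y: "Y \<noteq> {}" "card Y \<le> R"
    and pop: "\<And>c. c \<in> C \<Longrightarrow> \<theta> \<le> card {q\<in>Q. q * c \<in> P}" and "\<theta> > 0" and Z: "finite Z"
  shows "(\<Sum>z\<in>Z. real (difference_reps C Y z) ^ 3) * \<theta>^3 \<le> 769 * harm R * real N^4 * real (card Y)^2"
proof -
  have R1: "R \<ge> 1" using Y fin by (metis One_nat_def Suc_leI card_gt_0_iff order.trans)
  hence h: "(1::real) \<le> harm R" by (rule harm_ge_1)
  \<comment> \<open>The line of slope q and intercept q z; q and z can be recovered because q is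
    nonzero.\<close>
  define g where "g = (\<lambda>(q, z). (q, q * z :: real))"
  define L where "L = g ` (Q \<times> Z)"
  have inj: "inj_on g (Q \<times> Z)" unfolding g_def using \<open>0 \<notin> Q\<close> by (auto intro!: inj_onI)
  have fL: "finite L" unfolding L_def using fin Z by simp
  have reps: "real (difference_reps C Y z) * \<theta> \<le> (\<Sum>q\<in>Q. real (incidences Y P (g (q, z))))" for z
  proof -
    have "real (difference_reps C Y z) * \<theta> = (\<Sum>y\<in>{y\<in>Y. z + y \<in> C}. \<theta>)"
      unfolding difference_reps_def by simp
    also have "\<dots> \<le> (\<Sum>y\<in>{y\<in>Y. z + y \<in> C}. real (card {q\<in>Q. q * (z + y) \<in> P}))"
      by (rule sum_mono) (use pop in auto)
    also have "\<dots> \<le> (\<Sum>y\<in>Y. real (card {q\<in>Q. q * (z + y) \<in> P}))"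
      using fin by (intro sum_mono2) auto
    also have "\<dots> = (\<Sum>y\<in>Y. \<Sum>q\<in>Q. if q * (z + y) \<in> P then 1 else 0)"
      using fin by (intro sum.cong) (simp_all add: sum.inter_filter[symmetric])
    also have "\<dots> = (\<Sum>q\<in>Q. \<Sum>y\<in>Y. if q * (z + y) \<in> P then 1 else 0)" by (rule sum.swap)
    also have "\<dots> = (\<Sum>q\<in>Q. real (incidences Y P (g (q, z))))"
      unfolding incidences_def g_def using fin
      by (intro sum.cong) (simp_all add: sum.inter_filter[symmetric] algebra_simps)
    finally show ?thesis .
  qed
  \<comment> \<open>A line that is met is determined by q and a point (y, p) on it, so there are at
    most N^2 |Y| of them, absorbed by the main term N^2 |Y|^2.\<close>
  have "{l\<in>L. incidences Y P l \<ge> 1} \<subseteq> (\<lambda>(q, y, p). (q, p - q * y)) ` (Q \<times> Y \<times> P)"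
  proof
    fix l assume l: "l \<in> {l\<in>L. incidences Y P l \<ge> 1}"
    then obtain q z where qz: "l = (q, q * z)" "q \<in> Q" unfolding L_def g_def by auto
    have "{y\<in>Y. q * y + q * z \<in> P} \<noteq> {}"
    proof
      assume "{y\<in>Y. q * y + q * z \<in> P} = {}"
      hence "incidences Y P l = 0" unfolding qz incidences_def by (simp only: case_prod_conv card.empty)
      thus False using l by simp
    qed
    then obtain y where "y \<in> Y" "q * y + q * z \<in> P" by auto
    thus "l \<in> (\<lambda>(q, y, p). (q, p - q * y)) ` (Q \<times> Y \<times> P)"
      using qz by (intro image_eqI[of _ _ "(q, y, q * y + q * z)"]) auto
  qed
  hence "card {l\<in>L. incidences Y P l \<ge> 1} \<le> card ((\<lambda>(q, y, p). (q, p - q * y)) ` (Q \<times> Y \<times> P))"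
    using fin by (intro card_mono) auto
  also have "\<dots> \<le> card (Q \<times> Y \<times> P)" using fin by (intro card_image_le) auto
  also have "\<dots> \<le> N * (card Y * N)" using card by (simp add: card_cartesian_product mult_le_mono)
  finally have "real (card {l\<in>L. incidences Y P l \<ge> 1}) \<le> real (N * (card Y * N))" by (simp only: of_nat_le_iff)
  also have "\<dots> = real N^2 * (1 * real (card Y))" by (simp add: power2_eq_square)
  also have "\<dots> \<le> real N^2 * (real (card Y) * real (card Y))"
    using Y fin by (intro mult_left_mono mult_right_mono) (auto simp: Suc_le_eq card_gt_0_iff)
  finally have inc1: "real (card {l\<in>L. incidences Y P l \<ge> 1}) \<le> 1 * (real N^2 * real (card Y)^2)"
    by (simp add: power2_eq_square)
  have "(\<Sum>l\<in>L. real (incidences Y P l) ^ 3) \<le>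
      real (card {l\<in>L. incidences Y P l \<ge> 1}) + 768 * harm R * (real (card Y) * real (card P))^2"
    using fin fL Y \<open>0 \<notin> Q\<close> by (intro sum_incidences_cubed_le) (auto simp: L_def g_def)
  also have "\<dots> \<le> 1 * (real N^2 * real (card Y)^2) + 768 * harm R * (real (card Y) * real N)^2"
    using card by (intro add_mono inc1 mult_left_mono power_mono) (auto simp: harm_nonneg)
  also have "\<dots> \<le> harm R * (real N^2 * real (card Y)^2) + 768 * harm R * (real (card Y) * real N)^2"
    by (intro add_mono mult_right_mono h) (auto simp: harm_nonneg)
  also have "\<dots> = 769 * harm R * real N^2 * real (card Y)^2" by (simp add: power_mult_distrib)
  finally have cubes: "(\<Sum>l\<in>L. real (incidences Y P l) ^ 3) \<le> 769 * harm R * real N^2 * real (card Y)^2" .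
  have "(\<Sum>z\<in>Z. real (difference_reps C Y z) ^ 3) * \<theta>^3 = (\<Sum>z\<in>Z. (real (difference_reps C Y z) * \<theta>) ^ 3)"
    by (simp add: sum_distrib_right power_mult_distrib)
  also have "\<dots> \<le> (\<Sum>z\<in>Z. (\<Sum>q\<in>Q. real (incidences Y P (g (q, z)))) ^ 3)"
    using reps \<open>\<theta> > 0\<close> by (intro sum_mono power_mono) auto
  \<comment> \<open>Hoelder over the slopes costs N^2; the incidence bound supplies the other
    N^2.\<close>
  also have "\<dots> \<le> (\<Sum>z\<in>Z. real N^2 * (\<Sum>q\<in>Q. real (incidences Y P (g (q, z))) ^ 3))"
  proof (rule sum_mono)
    fix z
    have "(\<Sum>q\<in>Q. real (incidences Y P (g (q, z)))) ^ 3 \<le> real (card Q)^2 * (\<Sum>q\<in>Q. real (incidences Y P (g (q, z))) ^ 3)"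
      using fin by (intro cube_sum_le_card) auto
    also have "\<dots> \<le> real N^2 * (\<Sum>q\<in>Q. real (incidences Y P (g (q, z))) ^ 3)"
      using card by (intro mult_right_mono power_mono sum_nonneg) auto
    finally show "(\<Sum>q\<in>Q. real (incidences Y P (g (q, z)))) ^ 3 \<le> real N^2 * (\<Sum>q\<in>Q. real (incidences Y P (g (q, z))) ^ 3)" .
  qed
  also have "\<dots> = real N^2 * (\<Sum>q\<in>Q. \<Sum>z\<in>Z. real (incidences Y P (g (q, z))) ^ 3)"
    unfolding sum_distrib_left[symmetric] by (rule arg_cong, rule sum.swap)
  also have "(\<Sum>q\<in>Q. \<Sum>z\<in>Z. real (incidences Y P (g (q, z))) ^ 3) = (\<Sum>l\<in>L. real (incidences Y P l) ^ 3)"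
    unfolding L_def sum.reindex[OF inj] by (simp add: sum.cartesian_product split_def)
  also have "real N^2 * \<dots> \<le> real N^2 * (769 * harm R * real N^2 * real (card Y)^2)"
    by (intro mult_left_mono cubes) simp
  finally show ?thesis by (simp add: eval_nat_numeral mult_ac)
qed

lemma finite_diffset: "finite A \<Longrightarrow> finite B \<Longrightarrow> finite (diffset A B)"
  unfolding diffset_def by (simp add: finite_image_set2)

lemma sum_difference_reps:
  assumes "finite C" "finite Y" "finite Z" "diffset C Y \<subseteq> Z"
  shows "(\<Sum>z\<in>Z. difference_reps C Y z) = card C * card Y"
proof -
  have "card (C \<times> Y) = (\<Sum>z\<in>Z. card {p\<in>C \<times> Y. (\<lambda>(x, y). x - y) p = z})"
    by (rule card_eq_sum_fibres) (use assms in \<open>auto simp: diffset_def\<close>)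
  also have "\<dots> = (\<Sum>z\<in>Z. difference_reps C Y z)"
  proof (rule sum.cong[OF refl])
    fix z
    have "{p\<in>C \<times> Y. (\<lambda>(x, y). x - y) p = z} = (\<lambda>y. (z + y, y)) ` {y\<in>Y. z + y \<in> C}" by auto
    thus "card {p\<in>C \<times> Y. (\<lambda>(x, y). x - y) p = z} = difference_reps C Y z"
      unfolding difference_reps_def by (simp add: card_image inj_on_def)
  qed
  finally show ?thesis by (simp add: card_cartesian_product)
qed

text \<open>
  The argument of Schoen and Shkredov behind \<open>|C - C| \<ge> |C| powr (8 / 5)\<close> for convex sets \<open>C\<close>:
  a triple \<open>(a, b, c)\<close> gives the differences \<open>a - c\<close> and \<open>b - c\<close>, whose own difference \<open>a - b\<close> may
  be taken to be popular.
\<close>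

lemma card_pow_8_le:
  assumes C: "finite C" "C \<noteq> {}"
  defines "D \<equiv> diffset C C"
  shows "real (card C)^8 \<le> 8 * real (card D) *
    (\<Sum>z\<in>D. real (difference_reps C C z)^3) * (\<Sum>z\<in>diffset C D. real (difference_reps C D z)^2)"
proof -
  define r where "r = difference_reps C C"
  define n where "n = card C"
  define d where "d = card D"
  have fD: "finite D" unfolding D_def using C finite_diffset by auto
  have "0 \<in> D" unfolding D_def diffset_def using C by force
  hence d: "d > 0" unfolding d_def using fD by (auto simp: card_gt_0_iff)
  have n: "n > 0" unfolding n_def using C by (simp add: card_gt_0_iff)
  have sum_r: "(\<Sum>z\<in>D. r z) = n^2"
    unfolding r_def n_def power2_eq_square by (rule sum_difference_reps) (use C fD D_def in auto)
  \<comment> \<open>Differences with at least half the average multiplicity n^2 / d; they retain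
    half of all pairs.\<close>
  define D' where "D' = {z\<in>D. n^2 \<le> 2 * d * r z}"
  have "real n^2 \<le> 2 * (\<Sum>z\<in>D'. real (r z))"
  proof -
    have "(\<Sum>z\<in>D - D'. 2 * d * r z) \<le> (\<Sum>z\<in>D - D'. n^2)" unfolding D'_def by (intro sum_mono) auto
    also have "\<dots> \<le> d * n^2" unfolding d_def using fD by (simp add: card_mono)
    finally have "d * (2 * (\<Sum>z\<in>D - D'. r z)) \<le> d * n^2" by (simp add: sum_distrib_left mult_ac)
    hence "2 * (\<Sum>z\<in>D - D'. r z) \<le> n^2" using d by simp
    moreover have "(\<Sum>z\<in>D. r z) = (\<Sum>z\<in>D - D'. r z) + (\<Sum>z\<in>D'. r z)"
      by (rule sum.subset_diff) (use fD D'_def in auto)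
    ultimately have "n^2 \<le> 2 * (\<Sum>z\<in>D'. r z)" using sum_r by linarith
    hence "real (n^2) \<le> real (2 * (\<Sum>z\<in>D'. r z))" by (simp only: of_nat_le_iff)
    thus ?thesis by simp
  qed
  define V where "V = {(a, b, c). a \<in> C \<and> b \<in> C \<and> c \<in> C \<and> a - b \<in> D'}"
  define f where "f = (\<lambda>(a, b, c). (a - c, b - c :: real))"
  define J where "J = {(x, y). x \<in> D \<and> y \<in> D \<and> x - y \<in> D'}"
  have fV: "finite V" by (rule finite_subset[of _ "C \<times> C \<times> C"]) (use C in \<open>auto simp: V_def\<close>)
  have fJ: "finite J" by (rule finite_subset[of _ "D \<times> D"]) (use fD in \<open>auto simp: J_def\<close>)
  have V: "real n^3 \<le> 2 * real (card V)"
  proof -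
    have fD': "finite D'" unfolding D'_def using fD by simp
    have "card ((SIGMA z : D'. {b\<in>C. z + b \<in> C}) \<times> C) \<le> card V"
      by (rule card_inj_on_le[where f = "\<lambda>((z, b), c). (z + b, b, c)", OF _ _ fV])
        (auto simp: V_def inj_on_def)
    also have "card ((SIGMA z : D'. {b\<in>C. z + b \<in> C}) \<times> C) = (\<Sum>z\<in>D'. r z) * n"
      unfolding card_cartesian_product n_def r_def difference_reps_def
      using fD' C by (subst card_SigmaI) auto
    finally have "real ((\<Sum>z\<in>D'. r z) * n) \<le> real (card V)" by (simp only: of_nat_le_iff)
    hence "(\<Sum>z\<in>D'. real (r z)) * real n \<le> real (card V)" by simp
    moreover have "real n^2 * real n \<le> 2 * (\<Sum>z\<in>D'. real (r z)) * real n"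
      by (rule mult_right_mono) (use \<open>real n^2 \<le> _\<close> in auto)
    ultimately show ?thesis by (simp add: power2_eq_square power3_eq_cube)
  qed
  \<comment> \<open>Triples with the same image differ by a common translation z, and a, b, c each
    lie in the intersection of \<open>C\<close> with its translate by -z; this gives the third
    moment.\<close>
  have coll: "card {(u, v). u \<in> V \<and> v \<in> V \<and> f u = f v} \<le> (\<Sum>z\<in>D. r z ^ 3)"
  proof -
    let ?H = "\<lambda>z. {b\<in>C. z + b \<in> C}"
    let ?g = "\<lambda>((a, b, c), (a', b', c')). (a' - a, (a, b, c)) :: real \<times> real \<times> real \<times> real"
    have "card {(u, v). u \<in> V \<and> v \<in> V \<and> f u = f v} \<le> card (SIGMA z : D. ?H z \<times> ?H z \<times> ?H z)"
    proof (rule card_inj_on_le)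
      show "inj_on ?g {(u, v). u \<in> V \<and> v \<in> V \<and> f u = f v}"
        by (rule inj_onI) (auto simp: f_def)
      show "?g ` {(u, v). u \<in> V \<and> v \<in> V \<and> f u = f v} \<subseteq> (SIGMA z : D. ?H z \<times> ?H z \<times> ?H z)"
      proof
        fix w assume "w \<in> ?g ` {(u, v). u \<in> V \<and> v \<in> V \<and> f u = f v}"
        then obtain a b c a' b' c' where w: "w = (a' - a, (a, b, c))"
          "a \<in> C" "b \<in> C" "c \<in> C" "a' \<in> C" "b' \<in> C" "c' \<in> C" "a - c = a' - c'" "b - c = b' - c'"
          unfolding V_def f_def by auto
        have "a' - a + b = b'" "a' - a + c = c'" using w by linarith+
        hence "a' - a + b \<in> C" "a' - a + c \<in> C" using w(6,7) by (simp_all only:)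
        moreover have "a' - a \<in> D" unfolding D_def diffset_def using w by auto
        moreover have "a' - a + a \<in> C" using w by simp
        ultimately show "w \<in> (SIGMA z : D. ?H z \<times> ?H z \<times> ?H z)" unfolding w(1) using w(2-4) by blast
      qed
      show "finite (SIGMA z : D. ?H z \<times> ?H z \<times> ?H z)" using fD C by auto
    qed
    also have "\<dots> = (\<Sum>z\<in>D. r z ^ 3)"
      using fD C by (subst card_SigmaI) (auto simp: card_cartesian_product r_def difference_reps_def power3_eq_cube mult.assoc)
    finally show ?thesis .
  qed
  have "f ` V \<subseteq> J"
  proof
    fix w assume "w \<in> f ` V"
    then obtain a b c where "w = (a - c, b - c)" "a \<in> C" "b \<in> C" "c \<in> C" "a - b \<in> D'"
      unfolding f_def V_def by auto
    thus "w \<in> J" unfolding J_def D_def diffset_def by auto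
  qed
  hence cJ: "card (f ` V) \<le> card J" using fJ by (intro card_mono) auto
  \<comment> \<open>For (x, y) in \<open>J\<close> the popular x - y equals a - b in at least n^2 /
    (2d) ways, and then b - y = a - x. So \<open>J\<close> is bounded by coincidences among the
    differences of \<open>C\<close> and \<open>D\<close>.\<close>
  have J: "n^2 * card J \<le> 2 * d * (\<Sum>z\<in>diffset C D. difference_reps C D z ^ 2)"
  proof -
    let ?W = "SIGMA z : diffset C D. {y\<in>D. z + y \<in> C} \<times> {y\<in>D. z + y \<in> C}"
    let ?U = "SIGMA p : J. {b\<in>C. fst p - snd p + b \<in> C}"
    have "n^2 * card J = (\<Sum>p\<in>J. n^2)" by simp
    also have "\<dots> \<le> (\<Sum>p\<in>J. 2 * d * r (fst p - snd p))"
      by (rule sum_mono) (auto simp: J_def D'_def)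
    also have "\<dots> = 2 * d * card ?U"
      using fJ C by (subst card_SigmaI) (auto simp: r_def difference_reps_def sum_distrib_left)
    also have "card ?U \<le> card ?W"
    proof (rule card_inj_on_le[where f = "\<lambda>((x, y), b). (b - y, (y, x))"])
      show "inj_on (\<lambda>((x, y), b). (b - y, (y, x))) ?U" by (rule inj_onI) auto
      show "(\<lambda>((x, y), b). (b - y, (y, x))) ` ?U \<subseteq> ?W"
      proof
        fix w assume "w \<in> (\<lambda>((x, y), b). (b - y, (y, x))) ` ?U"
        then obtain x y b where w: "w = (b - y, (y, x))" "x \<in> D" "y \<in> D" "b \<in> C" "x - y + b \<in> C"
          unfolding J_def by auto
        have "b - y + x = x - y + b" by simp
        hence "b - y + x \<in> C" using w(5) by (simp only:)
        moreover have "b - y \<in> diffset C D" unfolding diffset_def using w by auto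
        ultimately show "w \<in> ?W" using w by auto
      qed
      show "finite ?W" using C(1) fD finite_diffset[OF C(1) fD] by (intro finite_SigmaI) auto
    qed
    also have "card ?W = (\<Sum>z\<in>diffset C D. difference_reps C D z ^ 2)"
      using C fD finite_diffset[OF C(1) fD]
      by (subst card_SigmaI) (auto simp: card_cartesian_product difference_reps_def power2_eq_square)
    finally show ?thesis by simp
  qed
  define E3 where "E3 = (\<Sum>z\<in>D. real (r z)^3)"
  define E2 where "E2 = (\<Sum>z\<in>diffset C D. real (difference_reps C D z)^2)"
  have E3: "E3 \<ge> 0" unfolding E3_def by (intro sum_nonneg) auto
  have J': "real n^2 * real (card J) \<le> 2 * real d * E2"
  proof -
    have "real (n^2 * card J) \<le> real (2 * d * (\<Sum>z\<in>diffset C D. difference_reps C D z ^ 2))"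
      using J by (simp only: of_nat_le_iff)
    thus ?thesis unfolding E2_def by simp
  qed
  have "(real n^3)^2 \<le> (2 * real (card V))^2" using V by (intro power_mono) auto
  also have "\<dots> = 4 * real (card V)^2" by (simp add: power2_eq_square)
  also have "\<dots> \<le> 4 * (real (card (f ` V)) * real (card {(u, v). u \<in> V \<and> v \<in> V \<and> f u = f v}))"
    by (intro mult_left_mono card_collisions fV) auto
  also have "\<dots> \<le> 4 * (real (card J) * E3)"
  proof -
    have "real (card {(u, v). u \<in> V \<and> v \<in> V \<and> f u = f v}) \<le> real (\<Sum>z\<in>D. r z ^ 3)"
      using coll by (simp only: of_nat_le_iff)
    hence "real (card {(u, v). u \<in> V \<and> v \<in> V \<and> f u = f v}) \<le> E3" unfolding E3_def by simp
    thus ?thesis using cJ by (intro mult_left_mono mult_mono) auto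
  qed
  finally have "(real n^3)^2 * real n^2 \<le> 4 * (real (card J) * E3) * real n^2" by (rule mult_right_mono) simp
  also have "\<dots> = 4 * E3 * (real n^2 * real (card J))" by simp
  also have "\<dots> \<le> 4 * E3 * (2 * real d * E2)" using E3 by (intro mult_left_mono J') auto
  finally have "real n^8 \<le> 8 * real d * E3 * E2" by (simp add: eval_nat_numeral mult_ac)
  thus ?thesis unfolding n_def d_def E3_def E2_def r_def .
qed

section \<open>The sum-product bound\<close>

lemma sum_product_inequality:
  fixes A :: "real set" and N R :: nat
  assumes A: "finite A" "A \<subseteq> {0<..}" "A \<noteq> {}"
    and N: "card (A + A) \<le> N" "card (diffset A A) \<le> N" "card (A * A) \<le> N" "card (A * inverse ` A) \<le> N"
    and R: "card A \<le> R" "card (diffset A A) \<le> R"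
    and small: "512 * harm R^2 * real N^2 \<le> real (card A)^4"
  shows "real (card A)^191 \<le> 10^126 * harm R^86 * real N^143"
proof -
  define h where "h = (harm R :: real)"
  define n where "n = real (card A)"
  have A0: "0 \<notin> A" using A(2) by auto
  have n: "n \<ge> 1" unfolding n_def using A by (simp add: Suc_le_eq card_gt_0_iff)
  have h: "h \<ge> 1" unfolding h_def using n R unfolding n_def by (intro harm_ge_1) linarith
  have N1: "real N \<ge> 1" using card_le_sumset[OF A(1,3)] N n unfolding n_def by linarith
  \<comment> \<open>The largest value that \<open>popular_quotients\<close> admits.\<close>
  define \<theta> where "\<theta> = n^20 / (10^12 * h^8 * real N^14)"
  have theta: "\<theta> > 0" unfolding \<theta>_def using n h N1 by simp
  have theta_eq: "\<theta> * (10^12 * h^8 * real N^14) = n^20" unfolding \<theta>_def using h N1 by simp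
  have "10^24 * h^16 * real N^28 * \<theta>^2 = (\<theta> * (10^12 * h^8 * real N^14))^2"
    by (simp add: power_mult_distrib power_mult[symmetric])
  also have "\<dots> = n^40" unfolding theta_eq by (simp add: power_mult[symmetric])
  finally have theta2: "10^24 * h^16 * real N^28 * \<theta>^2 \<le> n^40" by simp
  obtain C x where C: "C \<subseteq> A" "x \<in> A" "n \<le> 4 * h * card C"
    "\<And>c. c \<in> C \<Longrightarrow> \<theta> \<le> card {q \<in> A * A. c / x * q \<in> A * A}"
    using popular_quotients[OF A N(1,4) R(1)] small theta theta2 unfolding h_def n_def by blast
  have x: "x \<noteq> 0" using C(2) A0 by auto
  have fC: "finite C" by (rule finite_subset[OF C(1) A(1)])
  have C1: "C \<noteq> {}" using C(3) n by auto
  \<comment> \<open>Dilating by x clears the common denominator: c / x * q lies in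
    \<open>A * A\<close> exactly when q * c lies in \<open>P\<close>.\<close>
  define P where "P = (\<lambda>p. x * p) ` (A * A)"
  define Q where "Q = A * A"
  have fQ: "finite Q" unfolding Q_def using A by (simp add: finite_set_times)
  have fP: "finite P" unfolding P_def using A by (simp add: finite_set_times)
  have cP: "card P \<le> N" unfolding P_def using N(3) fQ unfolding Q_def by (meson card_image_le order.trans)
  have Q0: "0 \<notin> Q" unfolding Q_def using A0 by (auto simp: set_times_def)
  have pop: "\<theta> \<le> card {q\<in>Q. q * c \<in> P}" if "c \<in> C" for c
  proof -
    have "{q \<in> A * A. c / x * q \<in> A * A} \<subseteq> {q\<in>Q. q * c \<in> P}"
    proof
      fix q assume q: "q \<in> {q \<in> A * A. c / x * q \<in> A * A}"
      have "q * c = x * (c / x * q)" using x by simp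
      thus "q \<in> {q\<in>Q. q * c \<in> P}" using q unfolding Q_def P_def by blast
    qed
    hence "card {q \<in> A * A. c / x * q \<in> A * A} \<le> card {q\<in>Q. q * c \<in> P}" using fQ by (intro card_mono) auto
    thus ?thesis using C(4)[OF that] by linarith
  qed
  define D where "D = diffset C C"
  have DA: "D \<subseteq> diffset A A" unfolding D_def diffset_def using C(1) by blast
  have fD: "finite D" unfolding D_def using fC finite_diffset by auto
  have "card D \<le> card (diffset A A)" using DA A finite_diffset by (intro card_mono) auto
  hence cD: "card D \<le> N" "card D \<le> R" using N R by auto
  have D1: "D \<noteq> {}" unfolding D_def diffset_def using C1 by blast
  have CR: "card C \<le> R" using C(1) A R by (meson card_mono order.trans)
  define c where "c = real (card C)"
  define d where "d = real (card D)"
  define M where "M = 769 * h * real N^4"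
  define E3 where "E3 = (\<Sum>z\<in>D. real (difference_reps C C z)^3)"
  define E2 where "E2 = (\<Sum>z\<in>diffset C D. real (difference_reps C D z)^2)"
  define F3 where "F3 = (\<Sum>z\<in>diffset C D. real (difference_reps C D z)^3)"
  have pos: "c > 0" "d > 0" "M \<ge> 0" "E3 \<ge> 0" "E2 \<ge> 0" "F3 \<ge> 0"
    unfolding c_def d_def M_def E3_def E2_def F3_def using C1 D1 fC fD h
    by (auto simp: card_gt_0_iff intro!: sum_nonneg)
  have E3: "E3 * \<theta>^3 \<le> M * c^2"
    unfolding E3_def M_def c_def h_def
    by (rule sum_difference_reps_cubed_le[OF fC fC fP fQ Q0 cP _ C1 CR pop theta fD])
      (use N in \<open>auto simp: Q_def\<close>)
  have F3: "F3 * \<theta>^3 \<le> M * d^2"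
    unfolding F3_def M_def d_def h_def
    by (rule sum_difference_reps_cubed_le[OF fC fD fP fQ Q0 cP _ D1 cD(2) pop theta finite_diffset[OF fC fD]])
      (use N in \<open>auto simp: Q_def\<close>)
  have E2: "E2^2 \<le> (c * d) * F3"
  proof -
    have "(\<Sum>z\<in>diffset C D. difference_reps C D z) = card C * card D"
      by (rule sum_difference_reps) (use fC fD finite_diffset in auto)
    hence "real (\<Sum>z\<in>diffset C D. difference_reps C D z) = real (card C * card D)" by (simp only:)
    hence "(\<Sum>z\<in>diffset C D. real (difference_reps C D z)) = c * d" unfolding c_def d_def by simp
    moreover have "E2^2 \<le> (\<Sum>z\<in>diffset C D. real (difference_reps C D z)) * F3"
      unfolding E2_def F3_def by (rule sum_squares_le_sum_cubes) simp
    ultimately show ?thesis by simp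
  qed
  have "c^8 \<le> 8 * d * E3 * E2"
    using card_pow_8_le[OF fC C1] unfolding c_def d_def E3_def E2_def D_def .
  \<comment> \<open>Squaring lets \<open>E2\<close> be replaced by means of \<open>F3\<close>. The
    three third-moment factors then absorb \<theta>^9, and c^5 cancels.\<close>
  hence "(c^8)^2 \<le> (8 * d * E3 * E2)^2" by (rule power_mono) (use pos in auto)
  also have "\<dots> = (64 * d^2 * E3^2) * E2^2" by (simp add: power_mult_distrib)
  also have "\<dots> \<le> (64 * d^2 * E3^2) * ((c * d) * F3)" by (intro mult_left_mono E2) simp
  finally have "(c^8)^2 * \<theta>^9 \<le> ((64 * d^2 * E3^2) * ((c * d) * F3)) * \<theta>^9"
    by (rule mult_right_mono) (use theta in simp)
  also have "\<dots> = (64 * d^3 * c) * ((E3 * \<theta>^3)^2 * (F3 * \<theta>^3))"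
    by (simp add: power_mult_distrib power_mult[symmetric] eval_nat_numeral mult_ac)
  also have "\<dots> \<le> (64 * d^3 * c) * ((M * c^2)^2 * (M * d^2))"
    by (rule mult_left_mono[OF mult_mono[OF power_mono[OF E3] F3]]) (use pos theta in auto)
  also have "\<dots> = c^5 * (64 * M^3 * d^5)" by (simp add: power_mult_distrib eval_nat_numeral mult_ac)
  finally have "c^5 * (c^11 * \<theta>^9) \<le> c^5 * (64 * M^3 * d^5)"
    by (simp add: power_mult[symmetric] power_add[symmetric] mult.assoc[symmetric])
  hence "c^11 * \<theta>^9 \<le> 64 * M^3 * d^5"
    by (rule mult_left_le_imp_le) (use pos in simp)
  \<comment> \<open>Here the size of \<open>A - A\<close> enters: five factors N in addition to the
    twelve in M^3.\<close>
  also have "\<dots> \<le> 64 * M^3 * real N^5"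
    unfolding d_def using cD pos by (intro mult_left_mono power_mono) auto
  also have "\<dots> = 64 * 769^3 * (h^3 * real N^17)"
    unfolding M_def by (simp add: power_mult_distrib power_mult[symmetric] power_add[symmetric])
  finally have cc: "c^11 * \<theta>^9 \<le> 64 * 769^3 * (h^3 * real N^17)" .
  have "n^11 * \<theta>^9 \<le> (4 * h * c)^11 * \<theta>^9"
    using C(3) n theta unfolding c_def by (intro mult_right_mono power_mono) auto
  also have "\<dots> = (4^11 * h^11) * (c^11 * \<theta>^9)" by (simp only: power_mult_distrib mult_ac)
  also have "\<dots> \<le> (4^11 * h^11) * (64 * 769^3 * (h^3 * real N^17))" using h by (intro mult_left_mono cc) auto
  also have "\<dots> = (4^11 * 64 * 769^3) * (h^14 * real N^17)" by (simp add: power_add[symmetric])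
  also have "\<dots> \<le> 10^18 * (h^14 * real N^17)" using h by (intro mult_right_mono) auto
  finally have nn: "n^11 * \<theta>^9 \<le> 10^18 * (h^14 * real N^17)" .
  have "n^191 = n^11 * (n^20)^9" by (simp add: power_mult[symmetric] power_add[symmetric])
  also have "\<dots> = (n^11 * \<theta>^9) * (10^12 * h^8 * real N^14)^9"
    unfolding theta_eq[symmetric] by (simp only: power_mult_distrib mult_ac)
  also have "\<dots> \<le> (10^18 * (h^14 * real N^17)) * (10^12 * h^8 * real N^14)^9"
    using h by (intro mult_right_mono nn) auto
  also have "\<dots> = (10^18 * (10^12)^9) * (h^14 * (h^8)^9) * (real N^17 * (real N^14)^9)"
    by (simp only: power_mult_distrib mult_ac)
  also have "\<dots> = 10^126 * h^86 * real N^143"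
    by (simp only: power_mult[symmetric] power_add[symmetric]) simp
  finally show ?thesis unfolding h_def n_def .
qed

section \<open>Absorbing logarithms, and passing from positive to arbitrary reals\<close>

lemma harm_square_le:
  assumes "n \<ge> 1" and "a > 0"
  shows "harm (n^2) \<le> (1 + 2 / a) * real n powr a"
proof -
  \<comment> \<open>harm k - ln k decreases in k, so it is at most its value 1 at k = 1.\<close>
  have "harm (n^2) - ln (real (n^2)) \<le> harm 1 - ln (real 1)"
    by (rule euler_mascheroni_sequence_decreasing) (use assms in auto)
  moreover have "harm 1 = (1 :: real)" by (simp add: harm_def)
  ultimately have "harm (n^2) \<le> 1 + ln (real n ^ 2)" by simp
  also have "\<dots> = 1 + 2 * ln (real n)" using assms by (simp add: ln_realpow)
  also have "\<dots> \<le> real n powr a + 2 * (real n powr a / a)"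
    using assms by (intro add_mono mult_left_mono ln_powr_bound ge_one_powr_ge_zero) auto
  finally show ?thesis by (simp add: algebra_simps)
qed

lemma sum_product_positive:
  obtains K :: real where "K > 0" "\<And>(A :: real set) N. finite A \<Longrightarrow> A \<subseteq> {0<..} \<Longrightarrow> A \<noteq> {} \<Longrightarrow>
    card (A + A) \<le> N \<Longrightarrow> card (diffset A A) \<le> N \<Longrightarrow> card (A * A) \<le> N \<Longrightarrow>
    card (A * inverse ` A) \<le> N \<Longrightarrow> real (card A) powr (335 / 251) \<le> K * N"
proof -
  \<comment> \<open>191 - 143 * 335 / 251 = 36 / 251 is the slack in the exponent, shared among the
    86 logarithmic factors.\<close>
  define a :: real where "a = 36 / (251 * 86)"
  define c0 where "c0 = (1 + 2 / a)^86"
  have a: "a > 0" unfolding a_def by simp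
  have c0: "c0 \<ge> 1" unfolding c0_def using a by (intro one_le_power) simp
  define K where "K = 10^126 * c0"
  show thesis
  proof (rule that[of K])
    show "K > 0" unfolding K_def using c0 by simp
  next
    fix A :: "real set" and N :: nat
    assume A: "finite A" "A \<subseteq> {0<..}" "A \<noteq> {}" and N: "card (A + A) \<le> N" "card (diffset A A) \<le> N"
      "card (A * A) \<le> N" "card (A * inverse ` A) \<le> N"
    define n where "n = card A"
    define y where "y = real n powr (335 / 251)"
    define h where "h = (harm (n^2) :: real)"
    have n: "n \<ge> 1" unfolding n_def using A by (simp add: Suc_le_eq card_gt_0_iff)
    have y0: "y \<ge> 0" unfolding y_def by simp
    have h1: "h \<ge> 1" unfolding h_def using n by (intro harm_ge_1) simp
    have pow: "(real n powr b) ^ k = real n powr (real k * b)" for b k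
      by (subst powr_realpow[symmetric]) (use n in \<open>auto simp: powr_powr mult.commute\<close>)
    have "h \<le> (1 + 2 / a) * real n powr a" unfolding h_def by (rule harm_square_le[OF n a])
    hence "h^86 \<le> ((1 + 2 / a) * real n powr a)^86" using h1 by (intro power_mono) auto
    also have "\<dots> = c0 * real n powr (86 * a)"
      unfolding c0_def power_mult_distrib pow by simp
    also have "86 * a = 36 / 251" unfolding a_def by simp
    finally have h86: "h^86 \<le> c0 * real n powr (36 / 251)" .
    have pw: "y ^ k = real n powr (335 / 251 * real k)" for k
      unfolding y_def pow by (simp add: mult.commute)
    have npw: "real n ^ k = real n powr k" for k using n by (simp add: powr_realpow)
    \<comment> \<open>If the size condition fails, N is of order at least n^2 / h, far beyond the
      claim.\<close>
    show "real (card A) powr (335 / 251) \<le> K * N"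
    proof (cases "512 * h^2 * real N^2 \<le> real n^4")
      case True
      have "diffset A A = (\<lambda>(a, b). a - b) ` (A \<times> A)" unfolding diffset_def by auto
      hence "card (diffset A A) \<le> card (A \<times> A)" using card_image_le[of "A \<times> A"] A by simp
      hence dR: "card (diffset A A) \<le> n^2" unfolding n_def by (simp add: card_cartesian_product power2_eq_square)
      have nR: "card A \<le> n^2" unfolding n_def using n by (simp add: power2_eq_square n_def)
      have "real n^191 \<le> 10^126 * h^86 * real N^143"
        using sum_product_inequality[OF A N nR dR] True unfolding h_def n_def by simp
      also have "\<dots> \<le> 10^126 * (c0 * real n powr (36 / 251)) * real N^143"
        using h86 by (intro mult_right_mono mult_left_mono) auto
      also have "\<dots> = (K * real N^143) * real n powr (36 / 251)" unfolding K_def by simp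
      finally have "real n powr 191 \<le> (K * real N^143) * real n powr (36 / 251)" unfolding npw by simp
      also have "real n powr 191 = real n powr (335 / 251 * real 143) * real n powr (36 / 251)"
        using n by (simp add: powr_add[symmetric])
      finally have "y^143 \<le> K * real N^143" unfolding pw using n by simp
      also have "\<dots> \<le> K^143 * real N^143"
        using c0 unfolding K_def by (intro mult_right_mono self_le_power) auto
      finally have "y^143 \<le> (K * real N)^143" by (simp only: power_mult_distrib)
      moreover have "0 \<le> K * real N" using c0 unfolding K_def by simp
      ultimately have "y \<le> K * real N" using y0 power_mono_iff[of y "K * real N" 143] by simp
      thus ?thesis unfolding y_def n_def .
    next
      case False
      hence "real n^4 \<le> 512 * h^2 * real N^2" by simp
      also have "\<dots> \<le> 512 * h^86 * real N^2"
        using h1 by (intro mult_right_mono mult_left_mono power_increasing) auto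
      also have "\<dots> \<le> 512 * (c0 * real n powr (36 / 251)) * real N^2"
        using h86 by (intro mult_right_mono mult_left_mono) auto
      also have "\<dots> = (512 * c0 * real N^2) * real n powr (36 / 251)" by simp
      finally have "real n powr 4 \<le> (512 * c0 * real N^2) * real n powr (36 / 251)" unfolding npw by simp
      moreover have "real n powr (335 / 251 * real 2) * real n powr (36 / 251) \<le> real n powr 4"
        unfolding powr_add[symmetric] using n by (intro powr_mono) auto
      ultimately have "real n powr (335 / 251 * real 2) * real n powr (36 / 251) \<le>
          (512 * c0 * real N^2) * real n powr (36 / 251)" by linarith
      hence "y^2 \<le> 512 * c0 * real N^2" unfolding pw using n by simp
      also have "\<dots> \<le> K * real N^2" unfolding K_def using c0 by (intro mult_right_mono) auto
      also have "\<dots> \<le> K^2 * real N^2"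
        using c0 unfolding K_def by (intro mult_right_mono self_le_power) auto
      finally have "y^2 \<le> (K * real N)^2" by (simp only: power_mult_distrib)
      hence "y \<le> K * real N" by (rule power2_le_imp_le) (use c0 in \<open>auto simp: K_def\<close>)
      thus ?thesis unfolding y_def n_def .
    qed
  qed
qed

theorem theorem1p15:
  shows "gtrsim
    (\<lambda>A. real (card (A + A)) + real (card (diffset A A))
        + real (card (A * A)) + real (card (A * inverse ` A)))
    (\<lambda>A. real (card A) powr (4 / 3 + 1 / 753))"
proof -
  define s :: "real set \<Rightarrow> nat" where
    "s A = card (A + A) + card (diffset A A) + card (A * A) + card (A * inverse ` A)" for A
  obtain K :: real where K: "K > 0" and pos: "\<And>(A :: real set) N. finite A \<Longrightarrow> A \<subseteq> {0<..} \<Longrightarrow> A \<noteq> {} \<Longrightarrow>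
    card (A + A) \<le> N \<Longrightarrow> card (diffset A A) \<le> N \<Longrightarrow> card (A * A) \<le> N \<Longrightarrow>
    card (A * inverse ` A) \<le> N \<Longrightarrow> real (card A) powr (335 / 251) \<le> K * N"
    by (rule sum_product_positive) (rule that; blast)
  have s_mono: "s M \<le> s A" if "finite A" "M \<subseteq> A" for A M
  proof -
    have "M + M \<subseteq> A + A" "M * M \<subseteq> A * A" "M * inverse ` M \<subseteq> A * inverse ` A" "diffset M M \<subseteq> diffset A A"
      using set_plus_mono2[OF that(2,2)] set_times_mono2[OF that(2,2)]
        set_times_mono2[OF that(2) image_mono[OF that(2)]] that(2) unfolding diffset_def by blast+
    thus ?thesis unfolding s_def using that(1) finite_diffset
      by (intro add_mono card_mono) (auto simp: finite_set_plus finite_set_times)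
  qed
  have s_neg: "s (uminus ` M) = s M" for M :: "real set"
  proof -
    have "uminus ` M + uminus ` M = uminus ` (M + M)" by (force simp: set_plus_def)
    moreover have "uminus ` M * uminus ` M = M * M" by (force simp: set_times_def)
    moreover have "uminus ` M * inverse ` uminus ` M = M * inverse ` M" by (force simp: set_times_def)
    moreover have "diffset (uminus ` M) (uminus ` M) = uminus ` diffset M M"
    proof (intro equalityI subsetI)
      fix x assume "x \<in> diffset (uminus ` M) (uminus ` M)"
      then obtain a b where "a \<in> M" "b \<in> M" "x = - (a - b)" unfolding diffset_def by auto
      thus "x \<in> uminus ` diffset M M" unfolding diffset_def by blast
    next
      fix x assume "x \<in> uminus ` diffset M M"
      then obtain a b where ab: "a \<in> M" "b \<in> M" "x = - (a - b)" unfolding diffset_def by auto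
      hence "x = - a - (- b)" by simp
      thus "x \<in> diffset (uminus ` M) (uminus ` M)" unfolding diffset_def using ab by blast
    qed
    ultimately show ?thesis unfolding s_def by (simp add: card_image)
  qed
  have bound: "real (card A) powr (335 / 251) \<le> 4 powr (335 / 251) * K * s A" if A: "finite A" "card A \<ge> 2" for A
  proof -
    define P where "P = {a\<in>A. a > 0}"
    define M where "M = {a\<in>A. a < 0}"
    have "A \<subseteq> P \<union> M \<union> {0}" unfolding P_def M_def by auto
    hence "card A \<le> card (P \<union> M \<union> {0})" using A unfolding P_def M_def by (intro card_mono) auto
    also have "\<dots> \<le> card P + card M + 1" by (intro order.trans[OF card_Un_le] add_mono card_Un_le) auto
    finally have PM: "card A \<le> card P + card M + 1" .
    have "\<exists>B. finite B \<and> B \<subseteq> {0<..} \<and> s B \<le> s A \<and> card A \<le> 4 * card B"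
    proof (cases "card M \<le> card P")
      case True
      thus ?thesis using A PM s_mono[OF A(1), of P] by (intro exI[of _ P]) (auto simp: P_def)
    next
      case False
      have "card (uminus ` M) = card M" by (simp add: card_image)
      moreover have "M \<subseteq> A" "finite M" "uminus ` M \<subseteq> {0<..}" using A unfolding M_def by auto
      ultimately show ?thesis using False A PM s_mono[OF A(1), of M]
        by (intro exI[of _ "uminus ` M"]) (auto simp: s_neg)
    qed
    then obtain B where B: "finite B" "B \<subseteq> {0<..}" "s B \<le> s A" "card A \<le> 4 * card B" by blast
    have "B \<noteq> {}" using B(4) A(2) by auto
    have "real (card A) powr (335 / 251) \<le> (4 * real (card B)) powr (335 / 251)"
      using B(4) by (intro powr_mono2) auto
    also have "\<dots> = 4 powr (335 / 251) * real (card B) powr (335 / 251)" by (simp add: powr_mult)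
    also have "\<dots> \<le> 4 powr (335 / 251) * (K * s B)"
      by (intro mult_left_mono pos B \<open>B \<noteq> {}\<close>) (auto simp: s_def)
    also have "\<dots> \<le> 4 powr (335 / 251) * (K * s A)" using B(3) K by (intro mult_left_mono) auto
    finally show ?thesis by simp
  qed
  have e: "(4 / 3 + 1 / 753 :: real) = 335 / 251" by simp
  \<comment> \<open>The logarithms are already absorbed, so c = 1 serves: the factor ln |A| is at
    least ln 2, which enters the constant.\<close>
  have "\<forall>\<^sub>F A in principal {A :: real set. finite A \<and> 2 \<le> card A}. norm (real (card A) powr (335 / 251)) \<le>
    4 powr (335 / 251) * K / ln 2 * norm ((real (card (A + A)) + real (card (diffset A A)) +
      real (card (A * A)) + real (card (A * inverse ` A))) * ln (real (card A)) powr 1)"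
    unfolding eventually_principal
  proof
    fix A :: "real set" assume "A \<in> {A. finite A \<and> 2 \<le> card A}"
    hence A: "finite A" "card A \<ge> 2" by auto
    have l: "ln 2 \<le> ln (real (card A))" using A by simp
    have l2: "(0::real) < ln 2" by simp
    have "real (card A) powr (335 / 251) \<le> 4 powr (335 / 251) * K * s A * 1" using bound[OF A] by simp
    also have "\<dots> \<le> 4 powr (335 / 251) * K * s A * (ln (real (card A)) / ln 2)"
      using K l l2 by (intro mult_left_mono) (auto simp: le_divide_eq)
    also have "\<dots> = 4 powr (335 / 251) * K / ln 2 * (s A * ln (real (card A)))" by simp
    finally show "norm (real (card A) powr (335 / 251)) \<le>
      4 powr (335 / 251) * K / ln 2 * norm ((real (card (A + A)) + real (card (diffset A A)) +
        real (card (A * A)) + real (card (A * inverse ` A))) * ln (real (card A)) powr 1)"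
      using order.trans[OF less_imp_le[OF l2] l] by (simp add: s_def)
  qed
  hence "(\<lambda>A :: real set. real (card A) powr (335 / 251)) \<in> O[principal {A. finite A \<and> card A \<ge> 2}](\<lambda>A.
    (real (card (A + A)) + real (card (diffset A A)) + real (card (A * A)) +
      real (card (A * inverse ` A))) * ln (real (card A)) powr 1)"
    by (rule bigoI)
  moreover have "(0::real) < 1" by simp
  ultimately show ?thesis unfolding gtrsim_def e by blast
qed

end
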